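(* The Hilbert compression exponent of the wreath product $\mathbb{Z}\wr\mathbb{Z}$ equals $\frac23$, that is, $\alpha^*(\mathbb{Z}\wr\mathbb{Z})=\frac23$.
   Context: The wreath product $\mathbb{Z}\wr\mathbb{Z}$ is the group of all pairs $(f,x)$, where $x\in\mathbb{Z}$ and $f:\mathbb{Z}\to\mathbb{Z}$ has finite support, with group law $(f,x)(g,y)=\big(z\mapsto f(z)+g(z-x),\,x+y\big)$. It is finitely generated. For a finitely generated group $G$, fix a finite symmetric generating set $S\subseteq G$ ($S^{-1}=S$) and let $d$ be the left-invariant word metric on $G$ induced by $S$, i.e. $d(x,y)$ is the least $n\ge 0$ such that $x^{-1}y$ is a product of $n$ elements of $S$. The Hilbert compression exponent $\alpha^*(G)$ is the supremum over all $\alpha\ge 0$ such that there exist a $1$-Lipschitz mapping $f:G\to L_2$ (with respect to $d$ and the Hilbert space norm $\|\cdot\|_2$) and a constant $c>0$ such that $\|f(x)-f(y)\|_2\ge c\,d(x,y)^\alpha$ for all $x,y\in G$. The value $\alpha^*(G)$ does not depend on the choice of the finite symmetric generating set $S$. *)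

theory Defs
  imports
    "HOL-Analysis.Analysis"
    "HOL-Algebra.Generated_Groups"
begin

definition wreath_ZZ :: "((int \<Rightarrow> int) \<times> int) monoid" where
  "wreath_ZZ = \<lparr>
     carrier = {(f, x). finite {z. f z \<noteq> 0}},
     mult = (\<lambda>(f, x) (g, y). (\<lambda>z. f z + g (z - x), x + y)),
     one = (\<lambda>z. 0, 0)\<rparr>"

definition fin_sym_gen_set :: "('a, 'b) monoid_scheme \<Rightarrow> 'a set \<Rightarrow> bool" where
  "fin_sym_gen_set G S \<longleftrightarrow>
     finite S \<and> S \<subseteq> carrier G \<and> (m_inv G) ` S = S \<and> generate G S = carrier G"

definition word_dist :: "('a, 'b) monoid_scheme \<Rightarrow> 'a set \<Rightarrow> 'a \<Rightarrow> 'a \<Rightarrow> nat" where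
  "word_dist G S x y =
     (LEAST n. \<exists>ws. length ws = n \<and> set ws \<subseteq> S \<and>
        inv\<^bsub>G\<^esub> x \<otimes>\<^bsub>G\<^esub> y = foldr (mult G) ws \<one>\<^bsub>G\<^esub>)"

text \<open>
  Elements of \<open>L\<^sub>2 = L\<^sub>2([0,1])\<close> are represented by square-integrable functions; functions that
  agree almost everywhere are not identified, but have distance \<open>0\<close>.
\<close>

abbreviation unit_interval_measure :: "real measure" where
  "unit_interval_measure \<equiv> lebesgue_on {0..1}"

definition L2_space :: "(real \<Rightarrow> real) set" where
  "L2_space = {u \<in> borel_measurable unit_interval_measure.
     integrable unit_interval_measure (\<lambda>t. (u t)\<^sup>2)}"

definition L2_norm :: "(real \<Rightarrow> real) \<Rightarrow> real" where
  "L2_norm u = sqrt (LINT t|unit_interval_measure. (u t)\<^sup>2)"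

definition compression_admissible :: "('a, 'b) monoid_scheme \<Rightarrow> 'a set \<Rightarrow> real \<Rightarrow> bool" where
  "compression_admissible G S \<alpha> \<longleftrightarrow>
     (\<exists>F c. F \<in> carrier G \<rightarrow> L2_space \<and> c > 0 \<and>
        (\<forall>x\<in>carrier G. \<forall>y\<in>carrier G.
           L2_norm (\<lambda>t. F x t - F y t) \<le> real (word_dist G S x y)) \<and>
        (\<forall>x\<in>carrier G. \<forall>y\<in>carrier G.
           L2_norm (\<lambda>t. F x t - F y t) \<ge> c * real (word_dist G S x y) powr \<alpha>))"

text \<open>
  The supremum is taken in the extended reals, so that the value is meaningful even if the set of
  exponents is unbounded (as for finite groups). Since \<open>0 powr 0 = 0\<close>, the exponent \<open>0\<close> imposes no
  condition on pairs with \<open>x = y\<close>.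
\<close>

definition hilbert_compression_exponent :: "('a, 'b) monoid_scheme \<Rightarrow> 'a set \<Rightarrow> ereal" where
  "hilbert_compression_exponent G S = Sup {ereal \<alpha> | \<alpha>. 0 \<le> \<alpha> \<and> compression_admissible G S \<alpha>}"

lemma carrier_wreath: "(f, x) \<in> carrier wreath_ZZ \<longleftrightarrow> finite {z. f z \<noteq> 0}"
  and mult_wreath: "(f, x) \<otimes>\<^bsub>wreath_ZZ\<^esub> (g, y) = (\<lambda>z. f z + g (z - x), x + y)"
  and one_wreath: "\<one>\<^bsub>wreath_ZZ\<^esub> = (\<lambda>z. 0, 0)"
  by (simp_all add: wreath_ZZ_def)

lemma finite_support_shift:
  fixes f :: "int \<Rightarrow> int"
  assumes "finite {z. f z \<noteq> 0}"
  shows "finite {z. f (z - x) \<noteq> 0}"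
proof -
  have "{z. f (z - x) \<noteq> 0} = (\<lambda>z. z + x) ` {z. f z \<noteq> 0}"
    by (auto simp: image_iff) (metis diff_add_cancel)
  then show ?thesis using assms by simp
qed

lemma inv_wreath_aux:
  "(\<lambda>z. - f (z + x), - x) \<otimes>\<^bsub>wreath_ZZ\<^esub> (f, x) = \<one>\<^bsub>wreath_ZZ\<^esub>"
  by (simp add: mult_wreath one_wreath)

lemma group_wreath: "group wreath_ZZ"
proof (rule groupI)
  fix p q assume "p \<in> carrier wreath_ZZ" "q \<in> carrier wreath_ZZ"
  then obtain f x g y where p: "p = (f, x)" "q = (g, y)"
    and fin: "finite {z. f z \<noteq> 0}" "finite {z. g z \<noteq> 0}"
    by (metis carrier_wreath surj_pair)
  have "{z. f z + g (z - x) \<noteq> 0} \<subseteq> {z. f z \<noteq> 0} \<union> {z. g (z - x) \<noteq> 0}" by auto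
  then have "finite {z. f z + g (z - x) \<noteq> 0}"
    using fin finite_support_shift by (meson finite_Un finite_subset)
  then show "p \<otimes>\<^bsub>wreath_ZZ\<^esub> q \<in> carrier wreath_ZZ"
    by (simp add: p mult_wreath carrier_wreath)
next
  show "\<one>\<^bsub>wreath_ZZ\<^esub> \<in> carrier wreath_ZZ" by (simp add: one_wreath carrier_wreath)
next
  fix p q r :: "(int \<Rightarrow> int) \<times> int"
  show "p \<otimes>\<^bsub>wreath_ZZ\<^esub> q \<otimes>\<^bsub>wreath_ZZ\<^esub> r = p \<otimes>\<^bsub>wreath_ZZ\<^esub> (q \<otimes>\<^bsub>wreath_ZZ\<^esub> r)"
    by (cases p; cases q; cases r) (simp add: mult_wreath algebra_simps)
next
  fix p :: "(int \<Rightarrow> int) \<times> int"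
  show "\<one>\<^bsub>wreath_ZZ\<^esub> \<otimes>\<^bsub>wreath_ZZ\<^esub> p = p"
    by (cases p) (simp add: mult_wreath one_wreath)
next
  fix p assume "p \<in> carrier wreath_ZZ"
  then obtain f x where p: "p = (f, x)" and fin: "finite {z. f z \<noteq> 0}"
    by (metis carrier_wreath surj_pair)
  have "(\<lambda>z. - f (z + x), - x) \<in> carrier wreath_ZZ"
    using finite_support_shift[OF fin, of "- x"] by (simp add: carrier_wreath)
  then show "\<exists>q\<in>carrier wreath_ZZ. q \<otimes>\<^bsub>wreath_ZZ\<^esub> p = \<one>\<^bsub>wreath_ZZ\<^esub>"
    using inv_wreath_aux p by blast
qed

lemma inv_wreath:
  assumes "finite {z. f z \<noteq> 0}"
  shows "inv\<^bsub>wreath_ZZ\<^esub> (f, x) = (\<lambda>z. - f (z + x), - x)"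
proof (rule group.inv_equality[OF group_wreath inv_wreath_aux])
  show "(f, x) \<in> carrier wreath_ZZ" using assms by (simp add: carrier_wreath)
  show "(\<lambda>z. - f (z + x), - x) \<in> carrier wreath_ZZ"
    using finite_support_shift[OF assms, of "- x"] by (simp add: carrier_wreath)
qed

text \<open>The group is finitely generated, so finite symmetric generating sets exist.\<close>

lemma ex_fin_sym_gen_set_wreath: "\<exists>S. fin_sym_gen_set wreath_ZZ S"
proof -
  define \<delta> :: "int \<Rightarrow> int \<Rightarrow> int \<Rightarrow> int" where "\<delta> = (\<lambda>k w z. if z = w then k else 0)"
  define S :: "((int \<Rightarrow> int) \<times> int) set"
    where "S = {(\<lambda>z. 0, 1), (\<lambda>z. 0, - 1), (\<delta> 1 0, 0), (\<delta> (- 1) 0, 0)}"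
  interpret group wreath_ZZ by (rule group_wreath)
  have fin\<delta>: "finite {z. \<delta> k w z \<noteq> 0}" for k w
    by (rule finite_subset[of _ "{w}"]) (auto simp: \<delta>_def)
  have neg\<delta>: "(\<lambda>z. - \<delta> k w z) = \<delta> (- k) w" for k w by (auto simp: \<delta>_def)
  have Sc: "S \<subseteq> carrier wreath_ZZ" using fin\<delta> by (auto simp: S_def carrier_wreath)
  have Si: "m_inv wreath_ZZ ` S = S"
    using fin\<delta> by (auto simp: S_def inv_wreath neg\<delta>)
  let ?H = "generate wreath_ZZ S"
  have inc: "s \<in> ?H" if "s \<in> S" for s using that by (rule generate.incl)
  have mul: "(\<lambda>z. f z + g (z - x), x + y) \<in> ?H" if "(f, x) \<in> ?H" "(g, y) \<in> ?H" for f g x y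
    using generate.eng[OF that] by (simp add: mult_wreath)
  have one: "(\<lambda>z. 0, 0) \<in> ?H" using generate.one[of wreath_ZZ S] by (simp add: one_wreath)
  have T: "(\<lambda>z. 0, n) \<in> ?H" for n :: int
  proof (induction n rule: int_induct[of _ 0])
    case base show ?case by (rule one)
  next
    case (step1 i)
    then show ?case using mul[OF step1(2) inc, of "\<lambda>z. 0" 1] by (simp add: S_def)
  next
    case (step2 i)
    then show ?case using mul[OF step2(2) inc, of "\<lambda>z. 0" "- 1"] by (simp add: S_def)
  qed
  have A: "(\<delta> k 0, 0) \<in> ?H" for k :: int
  proof (induction k rule: int_induct[of _ 0])
    case base
    have "\<delta> 0 0 = (\<lambda>z. 0)" by (auto simp: \<delta>_def)
    then show ?case using one by simp
  next
    case (step1 i)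
    have "(\<lambda>z. \<delta> i 0 z + \<delta> 1 0 z) = \<delta> (i + 1) 0" by (auto simp: \<delta>_def)
    then show ?case using mul[OF step1(2) inc, of "\<delta> 1 0" 0] by (simp add: S_def)
  next
    case (step2 i)
    have "(\<lambda>z. \<delta> i 0 z + \<delta> (- 1) 0 z) = \<delta> (i - 1) 0" by (auto simp: \<delta>_def)
    then show ?case using mul[OF step2(2) inc, of "\<delta> (- 1) 0" 0] by (simp add: S_def)
  qed
  have B: "(\<delta> k w, 0) \<in> ?H" for k w
  proof -
    have "(\<lambda>z. \<delta> k 0 (z - w)) = \<delta> k w" by (auto simp: \<delta>_def)
    then show ?thesis using mul[OF mul[OF T[of w] A[of k]] T[of "- w"]] by simp
  qed
  have C: "(f, 0) \<in> ?H" if "finite X" "{z. f z \<noteq> 0} \<subseteq> X" for f X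
    using that
  proof (induction X arbitrary: f rule: finite_induct)
    case empty
    then have "f = (\<lambda>z. 0)" by auto
    then show ?case using one by simp
  next
    case (insert w X)
    have "{z. (f(w := 0)) z \<noteq> 0} \<subseteq> X" using insert.prems by auto
    then have *: "(f(w := 0), 0) \<in> ?H" by (rule insert.IH)
    have "(\<lambda>z. (f(w := 0)) z + \<delta> (f w) w z) = f" by (auto simp: \<delta>_def)
    then show ?case using mul[OF * B[of "f w" w]] by simp
  qed
  have "carrier wreath_ZZ \<subseteq> ?H"
  proof
    fix p assume "p \<in> carrier wreath_ZZ"
    then obtain f x where p: "p = (f, x)" and fin: "finite {z. f z \<noteq> 0}"
      by (metis carrier_wreath surj_pair)
    show "p \<in> ?H" using mul[OF C[OF fin order_refl] T[of x]] p by simp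
  qed
  then have "fin_sym_gen_set wreath_ZZ S"
    using generate_incl[OF Sc] Sc Si by (auto simp: fin_sym_gen_set_def S_def)
  then show ?thesis ..
qed

end

theory Submission
  imports Defs
begin

text \<open>
  All word metrics of a finitely generated group are bi-Lipschitz equivalent, so it suffices to treat
  the four generators that move the cursor by \<open>\<plusminus>1\<close> or change the lamp under the cursor by \<open>\<plusminus>1\<close>.
  Up to constants, the distance of \<open>(f, x)\<close> and \<open>(g, y)\<close> is the lamp cost \<open>\<Sum>\<bar>f - g\<bar>\<close> plus
  the length \<open>\<bar>x - y\<bar> + R\<close> of a tour, where \<open>R\<close> says how far the support of \<open>f - g\<close>
  reaches beyond the interval between \<open>x\<close> and \<open>y\<close>.

  Upper bound. Let \<open>F\<close> be 1-Lipschitz into \<open>L\<^sub>2\<close> and let \<open>W\<^sub>n\<close> be simple random walk. On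
  an amenable group, the mean over a Folner set of \<open>E \<parallel>F(x W\<^sub>n) - F(x)\<parallel>\<^sup>2\<close> at most doubles, up to a
  vanishing error, when \<open>n\<close> doubles. Indeed, translation by the first half of the walk turns
  \<open>\<parallel>F(x u v) - F(x)\<parallel>\<^sup>2\<close> into the squared distance of two i.i.d. points of a Hilbert space,
  whose mean is at most twice the mean squared distance to any centre (lemma
  \<open>mean_displacement_doubling\<close>). Hence an exponent \<open>\<alpha>\<close> forces
  \<open>E d(1, W\<^sub>n) powr (2\<alpha>) = O(n)\<close> for powers \<open>n\<close> of 2 (\<open>random_walk_compression_bound\<close>). In
  \<open>\<int> \<wr> \<int>\<close> the walk sees about \<open>sqrt n\<close> lamps, each about \<open>sqrt n\<close> times, which leaves values of
  order \<open>n powr (1/4)\<close>; so \<open>E d(1, W\<^sub>n)\<close> is at least of order \<open>n powr (3/4)\<close>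
  (\<open>walk_mean_lamps_abs\<close>), and \<open>3\<alpha>/2 \<le> 1\<close>.

  Lower bound. Embed \<open>(f, x)\<close> by the coordinates \<open>x\<close> and \<open>f z\<close>, together with, for every
  \<open>z > x\<close>, the vector \<open>(z - x) powr \<beta>\<close> times a basis vector that is labelled by \<open>z\<close> and the
  restriction of \<open>f\<close> to \<open>[z, \<infinity>)\<close>, and the mirror image of this for \<open>z < x\<close>. This is Lipschitz
  for \<open>\<beta> < 1/2\<close>, as the squared increments of \<open>k powr \<beta>\<close> are summable. If \<open>f\<close> and \<open>g\<close>
  differ at distance \<open>R\<close>, then about \<open>R\<close> of the labels differ, so that
  the images have distance \<open>s\<close> at least of order \<open>R powr (\<beta> + 1/2)\<close>, almost linear in \<open>R\<close>. The lamp
  coordinates give the \<open>\<ell>\<^sub>2\<close> norm of \<open>f - g\<close>, so by Cauchy-Schwarz the \<open>\<ell>\<^sub>1\<close> norm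
  is at most \<open>s\<close> times the root of the size of the support, which is about \<open>s powr (3/2)\<close>. Altogether
  \<open>d = O(s powr (1/\<alpha>))\<close> with \<open>\<alpha>\<close> tending to \<open>2/3\<close> as \<open>\<beta>\<close> tends to \<open>1/2\<close>
  (\<open>word_dist_le_coords_dist\<close>).
\<close>

section \<open>Word metrics and changes of generators\<close>

abbreviation word_eval :: "('a, 'b) monoid_scheme \<Rightarrow> 'a list \<Rightarrow> 'a" where
  "word_eval G ws \<equiv> foldr (mult G) ws \<one>\<^bsub>G\<^esub>"

context group begin

lemma word_eval_closed [simp]: "set ws \<subseteq> carrier G \<Longrightarrow> word_eval G ws \<in> carrier G"
  by (induction ws) auto

lemma word_eval_append:
  "set us \<subseteq> carrier G \<Longrightarrow> set vs \<subseteq> carrier G \<Longrightarrow>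
    word_eval G (us @ vs) = word_eval G us \<otimes> word_eval G vs"
  by (induction us) (auto simp: m_assoc)

lemma word_eval_rev_inv:
  "set ws \<subseteq> carrier G \<Longrightarrow> word_eval G (rev (map (m_inv G) ws)) = inv (word_eval G ws)"
proof (induction ws)
  case (Cons s ws)
  then have "m_inv G ` set ws \<subseteq> carrier G" by auto
  with Cons show ?case by (simp add: word_eval_append inv_mult_group del: foldr_append)
qed simp

lemma ex_word:
  assumes S: "fin_sym_gen_set G S" and g: "g \<in> carrier G"
  shows "\<exists>ws. set ws \<subseteq> S \<and> g = word_eval G ws"
proof -
  have Sc: "S \<subseteq> carrier G" and Si: "m_inv G ` S = S" and gen: "generate G S = carrier G"
    using S by (auto simp: fin_sym_gen_set_def)
  have single: "\<exists>ws. set ws \<subseteq> S \<and> s = word_eval G ws" if "s \<in> S" for s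
    by (rule exI[of _ "[s]"]) (use that Sc in auto)
  have "g \<in> generate G S" using g gen by simp
  then show ?thesis
  proof induction
    case one
    show ?case by (rule exI[of _ "[]"]) simp
  next
    case (incl h)
    then show ?case by (rule single)
  next
    case (inv h)
    then have "inv h \<in> S" using Si by blast
    then show ?case by (rule single)
  next
    case (eng h1 h2)
    then obtain us vs where "set us \<subseteq> S" "h1 = word_eval G us" "set vs \<subseteq> S" "h2 = word_eval G vs"
      by blast
    then show ?case
      using Sc by (intro exI[of _ "us @ vs"]) (auto simp: word_eval_append simp del: foldr_append)
  qed
qed

lemma word_dist_le:
  "set ws \<subseteq> S \<Longrightarrow> inv x \<otimes> y = word_eval G ws \<Longrightarrow> word_dist G S x y \<le> length ws"
  unfolding word_dist_def by (rule Least_le) blast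

lemma word_dist_word:
  assumes "fin_sym_gen_set G S" "x \<in> carrier G" "y \<in> carrier G"
  shows "\<exists>ws. length ws = word_dist G S x y \<and> set ws \<subseteq> S \<and> inv x \<otimes> y = word_eval G ws"
proof -
  have "\<exists>n ws. length ws = n \<and> set ws \<subseteq> S \<and> inv x \<otimes> y = word_eval G ws"
    using ex_word[OF assms(1), of "inv x \<otimes> y"] assms by auto
  then show ?thesis unfolding word_dist_def by (rule LeastI_ex)
qed

lemma word_dist_refl: "x \<in> carrier G \<Longrightarrow> word_dist G S x x = 0"
  using word_dist_le[of "[]" S x x] by simp

text \<open>
  Checking a Lipschitz condition for the word metric only requires looking at the edges of the
  Cayley graph.
\<close>

lemma le_word_dist_if_edges:
  fixes \<rho> :: "'a \<Rightarrow> 'a \<Rightarrow> real"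
  assumes S: "fin_sym_gen_set G S" and x: "x \<in> carrier G" and y: "y \<in> carrier G"
    and refl: "\<And>x. x \<in> carrier G \<Longrightarrow> \<rho> x x = 0"
    and tri: "\<And>x y z. x \<in> carrier G \<Longrightarrow> y \<in> carrier G \<Longrightarrow> z \<in> carrier G \<Longrightarrow> \<rho> x z \<le> \<rho> x y + \<rho> y z"
    and edge: "\<And>x s. x \<in> carrier G \<Longrightarrow> s \<in> S \<Longrightarrow> \<rho> x (x \<otimes> s) \<le> L"
  shows "\<rho> x y \<le> L * real (word_dist G S x y)"
proof -
  have Sc: "S \<subseteq> carrier G" using S by (simp add: fin_sym_gen_set_def)
  have *: "set ws \<subseteq> S \<Longrightarrow> x \<in> carrier G \<Longrightarrow> \<rho> x (x \<otimes> word_eval G ws) \<le> L * real (length ws)" for ws x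
  proof (induction ws arbitrary: x)
    case Nil
    then show ?case by (simp add: refl)
  next
    case (Cons s ws)
    have s: "s \<in> S" "s \<in> carrier G" and ws: "set ws \<subseteq> carrier G" using Cons.prems Sc by auto
    have "\<rho> x (x \<otimes> s \<otimes> word_eval G ws) \<le> \<rho> x (x \<otimes> s) + \<rho> (x \<otimes> s) (x \<otimes> s \<otimes> word_eval G ws)"
      using s ws Cons.prems by (intro tri) auto
    also have "\<dots> \<le> L + L * real (length ws)"
      using s ws Cons by (intro add_mono edge Cons.IH) auto
    finally show ?case using s ws Cons.prems by (simp add: m_assoc algebra_simps)
  qed
  obtain ws where "length ws = word_dist G S x y" "set ws \<subseteq> S" "inv x \<otimes> y = word_eval G ws"
    using word_dist_word[OF S x y] by blast
  moreover from this have "x \<otimes> word_eval G ws = y"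
    using x y by (metis inv_closed inv_inv inv_solve_left m_closed)
  ultimately show ?thesis using *[of ws x] x by simp
qed

lemma word_dist_triangle:
  assumes S: "fin_sym_gen_set G S" and "x \<in> carrier G" "y \<in> carrier G" "z \<in> carrier G"
  shows "word_dist G S x z \<le> word_dist G S x y + word_dist G S y z"
proof -
  have Sc: "S \<subseteq> carrier G" using S by (simp add: fin_sym_gen_set_def)
  obtain us where us: "length us = word_dist G S x y" "set us \<subseteq> S" "inv x \<otimes> y = word_eval G us"
    using word_dist_word[OF S] assms by blast
  obtain vs where vs: "length vs = word_dist G S y z" "set vs \<subseteq> S" "inv y \<otimes> z = word_eval G vs"
    using word_dist_word[OF S] assms by blast
  have "word_eval G (us @ vs) = (inv x \<otimes> y) \<otimes> (inv y \<otimes> z)"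
    using us vs Sc by (subst word_eval_append) auto
  also have "\<dots> = inv x \<otimes> z" using assms by (simp add: m_assoc[symmetric]) (simp add: m_assoc)
  finally show ?thesis using word_dist_le[of "us @ vs" S x z] us vs by simp
qed

text \<open>
  The constant bounds the lengths of the generators in \<open>S'\<close> with respect to \<open>S\<close>.
\<close>

lemma word_dist_bilipschitz:
  assumes S: "fin_sym_gen_set G S" and S': "fin_sym_gen_set G S'"
  shows "\<exists>K>0. \<forall>x\<in>carrier G. \<forall>y\<in>carrier G.
    real (word_dist G S x y) \<le> K * real (word_dist G S' x y)"
proof -
  have fin: "finite S'" and Sc': "S' \<subseteq> carrier G" using S' by (auto simp: fin_sym_gen_set_def)
  define K where "K = 1 + (\<Sum>s\<in>S'. real (word_dist G S \<one> s))"
  have edge: "real (word_dist G S x (x \<otimes> s)) \<le> K" if "x \<in> carrier G" "s \<in> S'" for x s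
  proof -
    have "inv x \<otimes> (x \<otimes> s) = inv \<one> \<otimes> s" using that Sc' by (auto simp: m_assoc[symmetric])
    then have "word_dist G S x (x \<otimes> s) = word_dist G S \<one> s" by (simp add: word_dist_def)
    moreover have "real (word_dist G S \<one> s) \<le> (\<Sum>s\<in>S'. real (word_dist G S \<one> s))"
      using that fin by (intro member_le_sum) auto
    ultimately show ?thesis by (simp add: K_def)
  qed
  have "K > 0" unfolding K_def by (intro add_pos_nonneg sum_nonneg) auto
  moreover have "real (word_dist G S x y) \<le> K * real (word_dist G S' x y)"
    if "x \<in> carrier G" "y \<in> carrier G" for x y
    by (rule le_word_dist_if_edges[OF S' that, of "\<lambda>x y. real (word_dist G S x y)"])
      (use edge word_dist_triangle[OF S] in \<open>auto simp: word_dist_refl simp flip: of_nat_add\<close>)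
  ultimately show ?thesis by blast
qed

end

lemma L2_norm_scale: "L2_norm (\<lambda>t. k * u t) = \<bar>k\<bar> * L2_norm u"
proof -
  have "(LINT t|unit_interval_measure. (k * u t)\<^sup>2) = k\<^sup>2 * (LINT t|unit_interval_measure. (u t)\<^sup>2)"
    by (simp add: power_mult_distrib)
  then show ?thesis by (simp add: L2_norm_def real_sqrt_mult)
qed

lemma L2_norm_nonneg: "0 \<le> L2_norm u"
  by (simp add: L2_norm_def)

text \<open>
  The normalization to 1-Lipschitz maps in the definition of the exponent is only a matter of scaling.
\<close>

lemma compression_admissible_rescale:
  assumes F: "F \<in> carrier G \<rightarrow> L2_space" and L: "L > 0" and c: "c > 0"
    and upper: "\<And>x y. x \<in> carrier G \<Longrightarrow> y \<in> carrier G \<Longrightarrow>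
      L2_norm (\<lambda>t. F x t - F y t) \<le> L * real (word_dist G S x y)"
    and lower: "\<And>x y. x \<in> carrier G \<Longrightarrow> y \<in> carrier G \<Longrightarrow>
      L2_norm (\<lambda>t. F x t - F y t) \<ge> c * real (word_dist G S x y) powr \<alpha>"
  shows "compression_admissible G S \<alpha>"
proof -
  let ?F = "\<lambda>x t. F x t / L"
  have norm: "L2_norm (\<lambda>t. ?F x t - ?F y t) = L2_norm (\<lambda>t. F x t - F y t) / L" for x y
    using L2_norm_scale[of "1 / L" "\<lambda>t. F x t - F y t"] L by (simp add: diff_divide_distrib)
  show ?thesis unfolding compression_admissible_def
  proof (intro exI[of _ ?F] exI[of _ "c / L"] conjI ballI)
    show "?F \<in> carrier G \<rightarrow> L2_space"
      using F by (auto simp: L2_space_def power_divide Pi_def)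
    show "c / L > 0" using c L by simp
  next
    fix x y assume xy: "x \<in> carrier G" "y \<in> carrier G"
    show "L2_norm (\<lambda>t. ?F x t - ?F y t) \<le> real (word_dist G S x y)"
      unfolding norm using upper[OF xy] L by (simp add: divide_le_eq mult.commute)
    show "L2_norm (\<lambda>t. ?F x t - ?F y t) \<ge> c / L * real (word_dist G S x y) powr \<alpha>"
      unfolding norm using divide_right_mono[OF lower[OF xy], of L] L by simp
  qed
qed

lemma compression_admissible_change_gens:
  assumes G: "group G" and S: "fin_sym_gen_set G S" and S': "fin_sym_gen_set G S'"
    and "0 \<le> \<alpha>" and adm: "compression_admissible G S \<alpha>"
  shows "compression_admissible G S' \<alpha>"
proof -
  obtain F c where F: "F \<in> carrier G \<rightarrow> L2_space" and c: "c > 0"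
    and up: "\<And>x y. x\<in>carrier G \<Longrightarrow> y\<in>carrier G \<Longrightarrow> L2_norm (\<lambda>t. F x t - F y t) \<le> real (word_dist G S x y)"
    and lo: "\<And>x y. x\<in>carrier G \<Longrightarrow> y\<in>carrier G \<Longrightarrow>
      c * real (word_dist G S x y) powr \<alpha> \<le> L2_norm (\<lambda>t. F x t - F y t)"
    using adm unfolding compression_admissible_def by blast
  obtain K where K: "K > 0" "\<And>x y. x\<in>carrier G \<Longrightarrow> y\<in>carrier G \<Longrightarrow>
      real (word_dist G S x y) \<le> K * real (word_dist G S' x y)"
    using group.word_dist_bilipschitz[OF G S S'] by blast
  obtain K' where K': "K' > 0" "\<And>x y. x\<in>carrier G \<Longrightarrow> y\<in>carrier G \<Longrightarrow>
      real (word_dist G S' x y) \<le> K' * real (word_dist G S x y)"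
    using group.word_dist_bilipschitz[OF G S' S] by blast
  show ?thesis
  proof (rule compression_admissible_rescale[OF F K(1), of "c / K' powr \<alpha>"])
    show "c / K' powr \<alpha> > 0" using c K' by simp
  next
    fix x y assume xy: "x \<in> carrier G" "y \<in> carrier G"
    show "L2_norm (\<lambda>t. F x t - F y t) \<le> K * real (word_dist G S' x y)"
      using up[OF xy] K(2)[OF xy] by linarith
    have "real (word_dist G S' x y) powr \<alpha> \<le> (K' * real (word_dist G S x y)) powr \<alpha>"
      using K'(2)[OF xy] \<open>0 \<le> \<alpha>\<close> by (intro powr_mono2) auto
    then have "c / K' powr \<alpha> * real (word_dist G S' x y) powr \<alpha>
        \<le> c / K' powr \<alpha> * (K' powr \<alpha> * real (word_dist G S x y) powr \<alpha>)"
      using c K'(1) by (intro mult_left_mono) (auto simp: powr_mult)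
    also have "\<dots> = c * real (word_dist G S x y) powr \<alpha>" using K'(1) by simp
    finally show "c / K' powr \<alpha> * real (word_dist G S' x y) powr \<alpha> \<le> L2_norm (\<lambda>t. F x t - F y t)"
      using lo[OF xy] by linarith
  qed
qed

section \<open>Displacement along random walks on amenable groups\<close>

text \<open>
  The steps of a random walk of \<open>n\<close> steps with uniform increments in \<open>S\<close>, as a finite probability
  space with uniform weights.
\<close>

definition words :: "'a set \<Rightarrow> nat \<Rightarrow> 'a list set" where
  "words S n = {ws. set ws \<subseteq> S \<and> length ws = n}"

lemma words_0 [simp]: "words S 0 = {[]}"
  by (auto simp: words_def)

lemma finite_words [simp]: "finite S \<Longrightarrow> finite (words S n)"
  by (simp add: words_def finite_lists_length_eq)

lemma card_words: "finite S \<Longrightarrow> card (words S n) = card S ^ n"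
  by (simp add: words_def card_lists_length_eq)

lemma sum_words_add:
  fixes g :: "'a list \<Rightarrow> 'b::comm_monoid_add"
  shows "(\<Sum>w\<in>words S (m + n). g w) = (\<Sum>u\<in>words S m. \<Sum>v\<in>words S n. g (u @ v))"
proof -
  have "(\<Sum>w\<in>words S (m + n). g w) = (\<Sum>(u, v)\<in>words S m \<times> words S n. g (u @ v))"
    by (rule sum.reindex_bij_witness[of _ "\<lambda>(u, v). u @ v" "\<lambda>w. (take m w, drop m w)"])
      (auto simp: words_def dest: in_set_takeD in_set_dropD)
  then show ?thesis by (simp add: sum.cartesian_product)
qed

lemma sum_words_1:
  fixes g :: "'a list \<Rightarrow> 'b::comm_monoid_add"
  shows "(\<Sum>w\<in>words S 1. g w) = (\<Sum>s\<in>S. g [s])"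
  by (rule sum.reindex_bij_witness[of _ "\<lambda>s. [s]" hd])
    (auto simp: words_def length_Suc_conv)

context group begin

lemma words_closed: "S \<subseteq> carrier G \<Longrightarrow> w \<in> words S n \<Longrightarrow> word_eval G w \<in> carrier G"
  by (intro word_eval_closed) (auto simp: words_def)

text \<open>
  The distribution of a symmetric random walk is invariant under inversion, as reversing a word and
  inverting its letters permutes the words.
\<close>

lemma sum_words_inv:
  fixes g :: "'a \<Rightarrow> 'c::comm_monoid_add"
  assumes Sc: "S \<subseteq> carrier G" and Si: "m_inv G ` S = S"
  shows "(\<Sum>w\<in>words S n. g (inv (word_eval G w))) = (\<Sum>w\<in>words S n. g (word_eval G w))"
proof -
  let ?r = "\<lambda>w. rev (map (m_inv G) w)"
  have mem: "?r w \<in> words S n" if "w \<in> words S n" for w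
    using that Si by (auto simp: words_def)
  have "map (m_inv G) (map (m_inv G) w) = w" if "w \<in> words S n" for w
    using that Sc by (auto simp: words_def intro!: map_idI)
  then have invol: "?r (?r w) = w" if "w \<in> words S n" for w
    using that by (simp add: rev_map)
  have ev: "word_eval G (?r w) = inv (word_eval G w)" if "w \<in> words S n" for w
    using that Sc by (intro word_eval_rev_inv) (auto simp: words_def)
  show ?thesis
    by (rule sum.reindex_bij_witness[of _ ?r ?r]) (use mem invol ev in auto)
qed

end

text \<open>
  For i.i.d. \<open>X, Y\<close> uniform on a finite family of points, \<open>E|X - Y|\<^sup>2 = 2 Var X \<le> 2 E|X - z|\<^sup>2\<close>.
\<close>

lemma sum_square_diff_le:
  fixes u :: "'i \<Rightarrow> real"
  assumes "finite I"
  shows "(\<Sum>i\<in>I. \<Sum>j\<in>I. (u i - u j)\<^sup>2) \<le> 2 * real (card I) * (\<Sum>i\<in>I. (u i - z)\<^sup>2)"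
proof -
  define v where "v i = u i - z" for i
  have "(\<Sum>i\<in>I. \<Sum>j\<in>I. (u i - u j)\<^sup>2) = (\<Sum>i\<in>I. \<Sum>j\<in>I. (v i)\<^sup>2 + (v j)\<^sup>2 - 2 * (v i * v j))"
    by (simp add: v_def power2_eq_square algebra_simps)
  also have "\<dots> = (\<Sum>i\<in>I. real (card I) * (v i)\<^sup>2 + (\<Sum>j\<in>I. (v j)\<^sup>2) - 2 * (v i * (\<Sum>j\<in>I. v j)))"
    by (simp add: sum.distrib sum_subtractf sum_distrib_left)
  also have "\<dots> = 2 * real (card I) * (\<Sum>i\<in>I. (v i)\<^sup>2) - 2 * (\<Sum>i\<in>I. v i)\<^sup>2"
    by (simp add: sum.distrib sum_subtractf power2_eq_square flip: sum_distrib_left sum_distrib_right)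
  also have "\<dots> \<le> 2 * real (card I) * (\<Sum>i\<in>I. (v i)\<^sup>2)" by simp
  finally show ?thesis by (simp add: v_def)
qed

text \<open>
  Working with squared distances turns the Hilbert space inequalities into integrals of pointwise ones.
\<close>

definition L2_sqdist :: "(real \<Rightarrow> real) \<Rightarrow> (real \<Rightarrow> real) \<Rightarrow> real" where
  "L2_sqdist u v = (LINT t|unit_interval_measure. (u t - v t)\<^sup>2)"

lemma L2_sqdist_norm: "L2_sqdist u v = (L2_norm (\<lambda>t. u t - v t))\<^sup>2"
  by (simp add: L2_sqdist_def L2_norm_def)

lemma L2_sqdist_nonneg: "0 \<le> L2_sqdist u v"
  by (simp add: L2_sqdist_norm)

lemma L2_sqdist_commute: "L2_sqdist u v = L2_sqdist v u"
  by (simp add: L2_sqdist_def power2_commute)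

lemma L2_sqdist_integrable:
  assumes "u \<in> L2_space" "v \<in> L2_space"
  shows "integrable unit_interval_measure (\<lambda>t. (u t - v t)\<^sup>2)"
proof (rule Bochner_Integration.integrable_bound)
  show "integrable unit_interval_measure (\<lambda>t. 2 * (u t)\<^sup>2 + 2 * (v t)\<^sup>2)"
    using assms by (auto simp: L2_space_def)
  show "(\<lambda>t. (u t - v t)\<^sup>2) \<in> borel_measurable unit_interval_measure"
    using assms by (auto simp: L2_space_def)
  show "AE t in unit_interval_measure. norm ((u t - v t)\<^sup>2) \<le> norm (2 * (u t)\<^sup>2 + 2 * (v t)\<^sup>2)"
  proof (rule AE_I2)
    fix t
    have "0 \<le> (u t + v t)\<^sup>2" "0 \<le> (u t - v t)\<^sup>2" by simp_all
    then show "norm ((u t - v t)\<^sup>2) \<le> norm (2 * (u t)\<^sup>2 + 2 * (v t)\<^sup>2)"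
      by (simp add: power2_eq_square algebra_simps)
  qed
qed

lemma sum_L2_sqdist_le:
  assumes I: "finite I" and u: "\<And>i. i \<in> I \<Longrightarrow> u i \<in> L2_space" and z: "z \<in> L2_space"
  shows "(\<Sum>i\<in>I. \<Sum>j\<in>I. L2_sqdist (u i) (u j)) \<le> 2 * real (card I) * (\<Sum>i\<in>I. L2_sqdist (u i) z)"
proof -
  have "(\<Sum>i\<in>I. \<Sum>j\<in>I. L2_sqdist (u i) (u j))
      = (LINT t|unit_interval_measure. (\<Sum>i\<in>I. \<Sum>j\<in>I. (u i t - u j t)\<^sup>2))"
    by (simp add: L2_sqdist_def L2_sqdist_integrable u Bochner_Integration.integral_sum
        Bochner_Integration.integrable_sum)
  also have "\<dots> \<le> (LINT t|unit_interval_measure. 2 * real (card I) * (\<Sum>i\<in>I. (u i t - z t)\<^sup>2))"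
    by (intro integral_mono sum_square_diff_le I Bochner_Integration.integrable_sum
        integrable_mult_right L2_sqdist_integrable u z)
  also have "\<dots> = 2 * real (card I) * (\<Sum>i\<in>I. L2_sqdist (u i) z)"
    by (simp add: L2_sqdist_def L2_sqdist_integrable u z Bochner_Integration.integral_sum)
  finally show ?thesis .
qed

definition mean :: "'a set \<Rightarrow> ('a \<Rightarrow> real) \<Rightarrow> real" where
  "mean A \<phi> = (\<Sum>x\<in>A. \<phi> x) / real (card A)"

lemma mean_sum: "mean A (\<lambda>x. \<Sum>i\<in>I. \<phi> i x) = (\<Sum>i\<in>I. mean A (\<phi> i))"
proof -
  have "(\<Sum>x\<in>A. \<Sum>i\<in>I. \<phi> i x) = (\<Sum>i\<in>I. \<Sum>x\<in>A. \<phi> i x)" by (rule sum.swap)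
  then show ?thesis by (simp add: mean_def sum_divide_distrib)
qed

lemma mean_mono: "(\<And>x. x \<in> A \<Longrightarrow> \<phi> x \<le> \<psi> x) \<Longrightarrow> mean A \<phi> \<le> mean A \<psi>"
  by (simp add: mean_def divide_right_mono sum_mono)

lemma mean_scale: "mean A (\<lambda>x. k * \<phi> x) = k * mean A \<phi>"
  by (simp add: mean_def sum_distrib_left)

lemma mean_const: "finite A \<Longrightarrow> A \<noteq> {} \<Longrightarrow> mean A (\<lambda>x. k) = k"
  by (simp add: mean_def)

text \<open>
  The sets \<open>A N\<close> are asymptotically invariant under right translations: this is the form in which
  amenability enters.
\<close>

locale folner_group = group G for G (structure) +
  fixes S :: "'a set" and A :: "nat \<Rightarrow> 'a set"
  assumes gens: "fin_sym_gen_set G S"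
    and folner_finite: "finite (A N)" and folner_nonempty: "A N \<noteq> {}"
    and folner_carrier: "A N \<subseteq> carrier G"
    and folner_boundary:
      "s \<in> S \<Longrightarrow> (\<lambda>N. real (card {x\<in>A N. x \<otimes> s \<notin> A N}) / real (card (A N))) \<longlonglongrightarrow> 0"
begin

lemma S_carrier: "S \<subseteq> carrier G" and S_finite: "finite S" and S_inv: "m_inv G ` S = S"
  using gens by (auto simp: fin_sym_gen_set_def)

text \<open>
  Translating by \<open>s\<close> exchanges at most the boundary \<open>{x\<in>A N. x \<otimes> s \<notin> A N}\<close> against equally many
  other points, whose contribution is bounded.
\<close>

lemma mean_shift_gen:
  assumes s: "s \<in> S" and bd: "\<And>x. x \<in> carrier G \<Longrightarrow> \<bar>\<phi> x\<bar> \<le> K"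
  shows "(\<lambda>N. mean (A N) (\<lambda>x. \<phi> (x \<otimes> s)) - mean (A N) \<phi>) \<longlonglongrightarrow> 0"
proof (rule Lim_null_comparison)
  let ?b = "\<lambda>N. {x\<in>A N. x \<otimes> s \<notin> A N}"
  show "(\<lambda>N. 2 * K * (real (card (?b N)) / real (card (A N)))) \<longlonglongrightarrow> 0"
    using tendsto_mult_right_zero[OF folner_boundary[OF s]] .
  show "\<forall>\<^sub>F N in sequentially. norm (mean (A N) (\<lambda>x. \<phi> (x \<otimes> s)) - mean (A N) \<phi>)
      \<le> 2 * K * (real (card (?b N)) / real (card (A N)))"
  proof (rule always_eventually, rule allI)
    fix N
    define B where "B = A N"
    define C where "C = (\<lambda>x. x \<otimes> s) ` B"
    have fin: "finite B" "finite C" using folner_finite by (auto simp: B_def C_def)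
    have sc: "s \<in> carrier G" using s S_carrier by auto
    have inj: "inj_on (\<lambda>x. x \<otimes> s) B"
      by (rule inj_on_subset[of _ "carrier G"]) (use sc folner_carrier in \<open>auto simp: inj_on_def B_def\<close>)
    have BC: "B \<subseteq> carrier G" "C \<subseteq> carrier G" using folner_carrier sc by (auto simp: B_def C_def)
    have C1: "card C = card B" unfolding C_def by (rule card_image[OF inj])
    have "C - B = (\<lambda>x. x \<otimes> s) ` ?b N" by (auto simp: C_def B_def)
    then have C2: "card (C - B) = card (?b N)"
      using card_image[OF inj_on_subset[OF inj, of "?b N"]] by (auto simp: B_def)
    have C3: "card (B - C) = card (C - B)"
      using C1 card_Diff_subset_Int[of B C] card_Diff_subset_Int[of C B] fin
      by (simp add: Int_commute)
    have "(\<Sum>x\<in>B. \<phi> (x \<otimes> s)) - (\<Sum>x\<in>B. \<phi> x) = sum \<phi> C - sum \<phi> B"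
      by (simp add: C_def sum.reindex[OF inj])
    also have "\<dots> = sum \<phi> (C - B) - sum \<phi> (B - C)"
      using fin by (simp add: sum_diff_split sum.Int_Diff[of C \<phi> B] sum.Int_Diff[of B \<phi> C] Int_commute)
    also have "\<bar>\<dots>\<bar> \<le> \<bar>sum \<phi> (C - B)\<bar> + \<bar>sum \<phi> (B - C)\<bar>" by (rule abs_triangle_ineq4)
    also have "\<dots> \<le> real (card (C - B)) * K + real (card (B - C)) * K"
    proof -
      have "\<bar>sum \<phi> X\<bar> \<le> real (card X) * K" if "X \<subseteq> carrier G" for X
        using order_trans[OF sum_abs sum_bounded_above, of X \<phi> K] bd that by auto
      moreover have "C - B \<subseteq> carrier G" "B - C \<subseteq> carrier G" using BC by auto
      ultimately show ?thesis by (intro add_mono)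
    qed
    finally have "\<bar>(\<Sum>x\<in>B. \<phi> (x \<otimes> s)) - (\<Sum>x\<in>B. \<phi> x)\<bar> \<le> 2 * K * real (card (?b N))"
      by (simp add: C2 C3)
    then show "norm (mean (A N) (\<lambda>x. \<phi> (x \<otimes> s)) - mean (A N) \<phi>)
      \<le> 2 * K * (real (card (?b N)) / real (card (A N)))"
      by (simp add: mean_def B_def diff_divide_distrib[symmetric] divide_right_mono)
  qed
qed

lemma mean_shift:
  assumes ws: "set ws \<subseteq> S" and bd: "\<And>x. x \<in> carrier G \<Longrightarrow> \<bar>\<phi> x\<bar> \<le> K"
  shows "(\<lambda>N. mean (A N) (\<lambda>x. \<phi> (x \<otimes> word_eval G ws)) - mean (A N) \<phi>) \<longlonglongrightarrow> 0"
  using assms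
proof (induction ws arbitrary: \<phi>)
  case Nil
  have "mean (A N) (\<lambda>x. \<phi> (x \<otimes> \<one>)) = mean (A N) \<phi>" for N
    unfolding mean_def using folner_carrier by (intro arg_cong2[of _ _ _ _ "(/)"] sum.cong) (auto simp: subset_iff)
  then show ?case by simp
next
  case (Cons s ws)
  let ?g = "word_eval G ws"
  have s: "s \<in> S" "s \<in> carrier G" and ws: "set ws \<subseteq> S" "set ws \<subseteq> carrier G"
    using Cons.prems S_carrier by auto
  have "(\<lambda>N. mean (A N) (\<lambda>x. \<phi> (x \<otimes> s \<otimes> ?g)) - mean (A N) (\<lambda>x. \<phi> (x \<otimes> ?g))) \<longlonglongrightarrow> 0"
    by (rule mean_shift_gen[OF s(1), of "\<lambda>x. \<phi> (x \<otimes> ?g)" K]) (use Cons.prems ws in auto)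
  moreover have "(\<lambda>N. mean (A N) (\<lambda>x. \<phi> (x \<otimes> ?g)) - mean (A N) \<phi>) \<longlonglongrightarrow> 0"
    using Cons ws by blast
  ultimately have "(\<lambda>N. mean (A N) (\<lambda>x. \<phi> (x \<otimes> s \<otimes> ?g)) - mean (A N) \<phi>) \<longlonglongrightarrow> 0"
    using tendsto_add by fastforce
  moreover have "mean (A N) (\<lambda>x. \<phi> (x \<otimes> s \<otimes> ?g)) = mean (A N) (\<lambda>x. \<phi> (x \<otimes> word_eval G (s # ws)))" for N
    unfolding mean_def using folner_carrier s ws
    by (intro arg_cong2[of _ _ _ _ "(/)"] sum.cong arg_cong[of _ _ \<phi>]) (auto simp: m_assoc subset_iff)
  ultimately show ?case by simp
qed

text \<open>
  The squared displacement of \<open>F\<close> from \<open>x\<close> after \<open>n\<close> steps, summed over all walks instead of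
  averaged.
\<close>

definition displacement :: "('a \<Rightarrow> real \<Rightarrow> real) \<Rightarrow> nat \<Rightarrow> 'a \<Rightarrow> real" where
  "displacement F n x = (\<Sum>w\<in>words S n. L2_sqdist (F (x \<otimes> word_eval G w)) (F x))"

context
  fixes F :: "'a \<Rightarrow> real \<Rightarrow> real"
  assumes F_space: "\<And>x. x \<in> carrier G \<Longrightarrow> F x \<in> L2_space"
    and F_lip: "\<And>x y. x \<in> carrier G \<Longrightarrow> y \<in> carrier G \<Longrightarrow>
      L2_norm (\<lambda>t. F x t - F y t) \<le> real (word_dist G S x y)"
begin

lemma L2_sqdist_word_le:
  assumes x: "x \<in> carrier G" and y: "y \<in> carrier G" and ws: "set ws \<subseteq> S"
    and eq: "inv x \<otimes> y = word_eval G ws"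
  shows "L2_sqdist (F x) (F y) \<le> (real (length ws))\<^sup>2"
proof -
  have "L2_norm (\<lambda>t. F x t - F y t) \<le> real (length ws)"
    using F_lip[OF x y] word_dist_le[OF ws eq] by linarith
  then show ?thesis unfolding L2_sqdist_norm by (rule power_mono[OF _ L2_norm_nonneg])
qed

text \<open>
  Write a walk of length \<open>m + m\<close> as \<open>u v\<close>. After the almost invisible translation by \<open>u\<inverse>\<close>, the
  displacement \<open>F(x u v) - F(x)\<close> becomes \<open>F(x v) - F(x u\<inverse>)\<close>, and by symmetry \<open>v\<close> and \<open>u\<inverse>\<close>
  are i.i.d.; so the variance inequality applies with centre \<open>F(x)\<close>. The errors \<open>\<epsilon>\<close> tend to 0 because
  only finitely many translations are involved for a fixed \<open>m\<close>.
\<close>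

lemma mean_displacement_doubling:
  "\<exists>\<epsilon>. \<epsilon> \<longlonglongrightarrow> 0 \<and> (\<forall>N. mean (A N) (displacement F (m + m)) \<le>
      2 * real (card S) ^ m * mean (A N) (displacement F m) + \<epsilon> N)"
proof -
  define \<phi> where "\<phi> u v x = L2_sqdist (F (x \<otimes> word_eval G v)) (F (x \<otimes> inv (word_eval G u)))" for u v x
  define \<epsilon> where "\<epsilon> N = (\<Sum>u\<in>words S m. \<Sum>v\<in>words S m.
      mean (A N) (\<lambda>x. \<phi> u v (x \<otimes> word_eval G u)) - mean (A N) (\<phi> u v))" for N
  have "\<epsilon> \<longlonglongrightarrow> 0"
  proof -
    have "\<epsilon> \<longlonglongrightarrow> (\<Sum>u\<in>words S m. \<Sum>v\<in>words S m. 0)"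
      unfolding \<epsilon>_def
    proof (intro tendsto_sum)
      fix u v assume u: "u \<in> words S m" and v: "v \<in> words S m"
      have uS: "set u \<subseteq> S" "set v \<subseteq> S" "set u \<subseteq> carrier G" "set v \<subseteq> carrier G"
        using u v S_carrier by (auto simp: words_def)
      show "(\<lambda>N. mean (A N) (\<lambda>x. \<phi> u v (x \<otimes> word_eval G u)) - mean (A N) (\<phi> u v)) \<longlonglongrightarrow> 0"
      proof (rule mean_shift[OF uS(1)])
        fix x assume x: "x \<in> carrier G"
        have "L2_sqdist (F (x \<otimes> inv (word_eval G u))) (F (x \<otimes> word_eval G v)) \<le> (real (length (u @ v)))\<^sup>2"
        proof (rule L2_sqdist_word_le)
          have "inv (x \<otimes> inv (word_eval G u)) \<otimes> (x \<otimes> word_eval G v)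
              = word_eval G u \<otimes> (inv x \<otimes> x) \<otimes> word_eval G v"
            using x uS by (simp only: inv_mult_group m_assoc word_eval_closed inv_closed m_closed inv_inv)
          also have "\<dots> = word_eval G (u @ v)"
            using x uS by (simp add: word_eval_append del: foldr_append)
          finally show "inv (x \<otimes> inv (word_eval G u)) \<otimes> (x \<otimes> word_eval G v) = word_eval G (u @ v)" .
        qed (use x uS in auto)
        then show "\<bar>\<phi> u v x\<bar> \<le> (real (length (u @ v)))\<^sup>2"
          by (simp add: \<phi>_def L2_sqdist_nonneg L2_sqdist_commute)
      qed
    qed
    then show ?thesis by simp
  qed
  moreover have "mean (A N) (displacement F (m + m)) \<le>
      2 * real (card S) ^ m * mean (A N) (displacement F m) + \<epsilon> N" for N
  proof -
    have "mean (A N) (displacement F (m + m))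
      = mean (A N) (\<lambda>x. \<Sum>u\<in>words S m. \<Sum>v\<in>words S m. \<phi> u v (x \<otimes> word_eval G u))"
    proof -
      have "displacement F (m + m) x = (\<Sum>u\<in>words S m. \<Sum>v\<in>words S m. \<phi> u v (x \<otimes> word_eval G u))"
        if "x \<in> A N" for x
        unfolding displacement_def sum_words_add
      proof (intro sum.cong refl)
        fix u v assume u: "u \<in> words S m" and v: "v \<in> words S m"
        have *: "set u \<subseteq> carrier G" "set v \<subseteq> carrier G" "x \<in> carrier G"
          using u v S_carrier that folner_carrier by (auto simp: words_def)
        show "L2_sqdist (F (x \<otimes> word_eval G (u @ v))) (F x) = \<phi> u v (x \<otimes> word_eval G u)"
          unfolding \<phi>_def using * by (simp add: word_eval_append m_assoc del: foldr_append)
      qed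
      then show ?thesis by (simp add: mean_def)
    qed
    also have "\<dots> = (\<Sum>u\<in>words S m. \<Sum>v\<in>words S m. mean (A N) (\<phi> u v)) + \<epsilon> N"
      by (simp add: mean_sum \<epsilon>_def sum_subtractf)
    also have "(\<Sum>u\<in>words S m. \<Sum>v\<in>words S m. mean (A N) (\<phi> u v))
      = mean (A N) (\<lambda>x. \<Sum>u\<in>words S m. \<Sum>v\<in>words S m. \<phi> u v x)"
      by (simp add: mean_sum)
    also have "\<dots> \<le> mean (A N) (\<lambda>x. 2 * real (card S) ^ m * displacement F m x)"
    proof (rule mean_mono)
      fix x assume "x \<in> A N"
      then have x: "x \<in> carrier G" using folner_carrier by auto
      have "(\<Sum>u\<in>words S m. \<Sum>v\<in>words S m. \<phi> u v x) = (\<Sum>u\<in>words S m. \<Sum>v\<in>words S m.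
          L2_sqdist (F (x \<otimes> word_eval G v)) (F (x \<otimes> word_eval G u)))"
        unfolding \<phi>_def
        by (rule sum_words_inv[OF S_carrier S_inv, where g = "\<lambda>h. \<Sum>v\<in>words S m.
          L2_sqdist (F (x \<otimes> word_eval G v)) (F (x \<otimes> h))"])
      also have "\<dots> = (\<Sum>u\<in>words S m. \<Sum>v\<in>words S m.
          L2_sqdist (F (x \<otimes> word_eval G u)) (F (x \<otimes> word_eval G v)))"
        by (rule sum.swap)
      also have "\<dots> \<le> 2 * real (card (words S m)) * displacement F m x"
        unfolding displacement_def
        by (intro sum_L2_sqdist_le finite_words S_finite F_space m_closed x words_closed[OF S_carrier])
      finally show "(\<Sum>u\<in>words S m. \<Sum>v\<in>words S m. \<phi> u v x)
          \<le> 2 * real (card S) ^ m * displacement F m x"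
        by (simp add: card_words S_finite)
    qed
    finally show ?thesis by (simp add: mean_scale)
  qed
  ultimately show ?thesis by blast
qed

lemma mean_displacement_pow2:
  "\<exists>\<epsilon>. \<epsilon> \<longlonglongrightarrow> 0 \<and> (\<forall>N. mean (A N) (displacement F (2 ^ k)) \<le>
      2 ^ k * real (card S) ^ (2 ^ k) + \<epsilon> N)"
proof (induction k)
  case 0
  have "displacement F 1 x \<le> real (card S)" if x: "x \<in> carrier G" for x
  proof -
    have "L2_sqdist (F (x \<otimes> s)) (F x) \<le> 1" if s: "s \<in> S" for s
    proof -
      have sc: "s \<in> carrier G" using s S_carrier by auto
      have "inv x \<otimes> (x \<otimes> s) = word_eval G [s]" using x sc by (simp add: m_assoc[symmetric])
      then show ?thesis
        using L2_sqdist_word_le[of x "x \<otimes> s" "[s]"] x s sc by (simp add: L2_sqdist_commute)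
    qed
    then have "(\<Sum>s\<in>S. L2_sqdist (F (x \<otimes> s)) (F x)) \<le> of_nat (card S) * 1"
      by (intro sum_bounded_above) auto
    moreover have "displacement F 1 x = (\<Sum>s\<in>S. L2_sqdist (F (x \<otimes> s)) (F x))"
      unfolding displacement_def sum_words_1
      using S_carrier by (intro sum.cong refl) (auto simp: subset_iff)
    ultimately show ?thesis by simp
  qed
  then have "mean (A N) (displacement F 1) \<le> mean (A N) (\<lambda>x. real (card S))" for N
    using folner_carrier by (intro mean_mono) auto
  then show ?case
    by (intro exI[of _ "\<lambda>N. 0"]) (simp add: mean_const folner_finite folner_nonempty)
next
  case (Suc k)
  then obtain \<epsilon> where \<epsilon>: "\<epsilon> \<longlonglongrightarrow> 0"
    "\<And>N. mean (A N) (displacement F (2 ^ k)) \<le> 2 ^ k * real (card S) ^ (2 ^ k) + \<epsilon> N" by blast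
  obtain \<delta> where \<delta>: "\<delta> \<longlonglongrightarrow> 0" "\<And>N. mean (A N) (displacement F (2 ^ k + 2 ^ k)) \<le>
      2 * real (card S) ^ (2 ^ k) * mean (A N) (displacement F (2 ^ k)) + \<delta> N"
    using mean_displacement_doubling[of "2 ^ k"] by blast
  define q where "q = real (card S) ^ (2 ^ k)"
  show ?case
  proof (intro exI conjI allI)
    show "(\<lambda>N. 2 * q * \<epsilon> N + \<delta> N) \<longlonglongrightarrow> 0"
      using tendsto_add[OF tendsto_mult_right_zero[OF \<epsilon>(1)] \<delta>(1)] by simp
    fix N
    have "mean (A N) (displacement F (2 ^ k + 2 ^ k)) \<le> 2 * q * mean (A N) (displacement F (2 ^ k)) + \<delta> N"
      using \<delta>(2)[of N] by (simp only: q_def)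
    also have "\<dots> \<le> 2 * q * (2 ^ k * q + \<epsilon> N) + \<delta> N"
      using \<epsilon>(2)[of N] unfolding q_def by (intro add_mono mult_left_mono) auto
    also have "\<dots> = (2 * 2 ^ k) * (q * q) + (2 * q * \<epsilon> N + \<delta> N)"
      by (simp only: ring_distribs mult_ac add_ac)
    finally have 1: "mean (A N) (displacement F (2 ^ k + 2 ^ k)) \<le> (2 * 2 ^ k) * (q * q) + (2 * q * \<epsilon> N + \<delta> N)" .
    have 2: "q * q = real (card S) ^ (2 ^ k + 2 ^ k)"
      unfolding q_def power_add by (rule refl)
    show "mean (A N) (displacement F (2 ^ Suc k))
      \<le> 2 ^ Suc k * real (card S) ^ (2 ^ Suc k) + (2 * q * \<epsilon> N + \<delta> N)"
      using 1 unfolding 2 power_Suc mult_2 .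
  qed
qed

end

text \<open>
  A walk of \<open>n\<close> steps displaces \<open>F\<close> by at most \<open>sqrt n\<close> in quadratic mean, so a compression
  function \<open>t powr \<alpha>\<close> limits how fast the walk can escape.
\<close>

lemma random_walk_compression_bound:
  assumes "compression_admissible G S \<alpha>"
  shows "\<exists>c>0. \<forall>k. c * (\<Sum>w\<in>words S (2 ^ k). real (word_dist G S \<one> (word_eval G w)) powr (2 * \<alpha>))
      \<le> 2 ^ k * real (card S) ^ (2 ^ k)"
proof -
  obtain F c where F: "F \<in> carrier G \<rightarrow> L2_space" and c: "c > 0"
    and up: "\<And>x y. x\<in>carrier G \<Longrightarrow> y\<in>carrier G \<Longrightarrow> L2_norm (\<lambda>t. F x t - F y t) \<le> real (word_dist G S x y)"
    and lo: "\<And>x y. x\<in>carrier G \<Longrightarrow> y\<in>carrier G \<Longrightarrow>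
      c * real (word_dist G S x y) powr \<alpha> \<le> L2_norm (\<lambda>t. F x t - F y t)"
    using assms unfolding compression_admissible_def by blast
  have FL: "\<And>x. x \<in> carrier G \<Longrightarrow> F x \<in> L2_space" using F by auto
  have "c\<^sup>2 * (\<Sum>w\<in>words S (2 ^ k). real (word_dist G S \<one> (word_eval G w)) powr (2 * \<alpha>))
      \<le> 2 ^ k * real (card S) ^ (2 ^ k)" (is "?l \<le> ?r") for k
  proof -
    obtain \<epsilon> where \<epsilon>: "\<epsilon> \<longlonglongrightarrow> 0"
      "\<And>N. mean (A N) (displacement F (2 ^ k)) \<le> 2 ^ k * real (card S) ^ (2 ^ k) + \<epsilon> N"
      using mean_displacement_pow2[OF FL up] by blast
    have "?l \<le> displacement F (2 ^ k) x" if x: "x \<in> carrier G" for x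
      unfolding sum_distrib_left displacement_def
    proof (rule sum_mono)
      fix w assume w: "w \<in> words S (2 ^ k)"
      let ?g = "word_eval G w"
      have g: "?g \<in> carrier G" using words_closed[OF S_carrier w] .
      have "inv x \<otimes> (x \<otimes> ?g) = inv \<one> \<otimes> ?g" using x g by (simp add: m_assoc[symmetric])
      then have "word_dist G S \<one> ?g = word_dist G S x (x \<otimes> ?g)" by (simp add: word_dist_def)
      then have "c * real (word_dist G S \<one> ?g) powr \<alpha> \<le> L2_norm (\<lambda>t. F x t - F (x \<otimes> ?g) t)"
        using lo[of x "x \<otimes> ?g"] x g by simp
      then have "(c * real (word_dist G S \<one> ?g) powr \<alpha>)\<^sup>2 \<le> L2_sqdist (F x) (F (x \<otimes> ?g))"
        unfolding L2_sqdist_norm using c by (intro power_mono) auto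
      also have "(c * real (word_dist G S \<one> ?g) powr \<alpha>)\<^sup>2 = c\<^sup>2 * real (word_dist G S \<one> ?g) powr (2 * \<alpha>)"
        by (simp add: power_mult_distrib power2_eq_square powr_add[symmetric])
      finally show "c\<^sup>2 * real (word_dist G S \<one> ?g) powr (2 * \<alpha>) \<le> L2_sqdist (F (x \<otimes> ?g)) (F x)"
        by (simp add: L2_sqdist_def power2_commute)
    qed
    then have "?l \<le> mean (A N) (displacement F (2 ^ k))" for N
      using mean_mono[of "A N" "\<lambda>x. ?l" "displacement F (2 ^ k)"] folner_carrier
      by (auto simp: mean_const folner_finite folner_nonempty)
    then have "?l \<le> ?r + \<epsilon> N" for N using \<epsilon>(2) order_trans by blast
    moreover have "(\<lambda>N. ?r + \<epsilon> N) \<longlonglongrightarrow> ?r + 0" by (intro tendsto_intros \<epsilon>)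
    ultimately show ?thesis by (intro LIMSEQ_le_const[of "\<lambda>N. ?r + \<epsilon> N"]) auto
  qed
  then show ?thesis using c by (intro exI[of _ "c\<^sup>2"]) auto
qed

end

section \<open>Standard generators and Folner sets of the wreath product\<close>

interpretation wr: group wreath_ZZ by (rule group_wreath)

abbreviation fin_supp :: "(int \<Rightarrow> int) \<Rightarrow> bool" where
  "fin_supp f \<equiv> finite {z. f z \<noteq> 0}"

definition cursor_move :: "int \<Rightarrow> (int \<Rightarrow> int) \<times> int" where
  "cursor_move s = (\<lambda>z. 0, s)"

definition lamp_change :: "int \<Rightarrow> (int \<Rightarrow> int) \<times> int" where
  "lamp_change e = (\<lambda>z. if z = 0 then e else 0, 0)"

definition std_gens :: "((int \<Rightarrow> int) \<times> int) set" where
  "std_gens = {cursor_move 1, cursor_move (- 1), lamp_change 1, lamp_change (- 1)}"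

lemma wreath_carrierE:
  assumes "p \<in> carrier wreath_ZZ"
  obtains f x where "p = (f, x)" "fin_supp f"
  using assms by (metis carrier_wreath surj_pair)

lemma fin_supp_upd [simp]: "fin_supp f \<Longrightarrow> fin_supp (f(x := y))"
  by (rule finite_subset[of _ "insert x {z. f z \<noteq> 0}"]) auto

lemma cursor_move_carrier [simp]: "cursor_move s \<in> carrier wreath_ZZ"
  by (simp add: cursor_move_def carrier_wreath)

lemma lamp_change_carrier [simp]: "lamp_change e \<in> carrier wreath_ZZ"
  by (simp add: lamp_change_def carrier_wreath)

lemma mult_cursor_move: "(f, x) \<otimes>\<^bsub>wreath_ZZ\<^esub> cursor_move s = (f, x + s)"
  by (simp add: cursor_move_def mult_wreath)

lemma mult_lamp_change: "(f, x) \<otimes>\<^bsub>wreath_ZZ\<^esub> lamp_change e = (f(x := f x + e), x)"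
  by (auto simp: lamp_change_def mult_wreath)

lemma cursor_move_mult: "cursor_move s \<otimes>\<^bsub>wreath_ZZ\<^esub> (f, x) = (\<lambda>z. f (z - s), s + x)"
  by (simp add: cursor_move_def mult_wreath)

lemma lamp_change_mult: "lamp_change e \<otimes>\<^bsub>wreath_ZZ\<^esub> (f, x) = (f(0 := e + f 0), x)"
  by (auto simp: lamp_change_def mult_wreath)

lemma inv_cursor_move: "inv\<^bsub>wreath_ZZ\<^esub> (cursor_move s) = cursor_move (- s)"
  by (simp add: cursor_move_def inv_wreath)

lemma inv_lamp_change: "inv\<^bsub>wreath_ZZ\<^esub> (lamp_change e) = lamp_change (- e)"
proof -
  have "fin_supp (\<lambda>z. if z = 0 then e else 0)"
    using lamp_change_carrier[of e] by (simp only: lamp_change_def carrier_wreath)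
  then show ?thesis by (auto simp: lamp_change_def inv_wreath)
qed

lemma std_gens_carrier: "std_gens \<subseteq> carrier wreath_ZZ"
  by (auto simp: std_gens_def)

lemma sum_std_gens:
  "(\<Sum>s\<in>std_gens. g s) =
    g (cursor_move 1) + g (cursor_move (- 1)) + g (lamp_change 1) + (g (lamp_change (- 1)) :: real)"
proof -
  have "cursor_move s \<noteq> lamp_change e" if "s \<noteq> 0" for s e
    using that by (simp add: cursor_move_def lamp_change_def)
  moreover have "cursor_move 1 \<noteq> cursor_move (- 1)" by (simp add: cursor_move_def)
  moreover have "lamp_change 1 \<noteq> lamp_change (- 1)"
    by (simp add: lamp_change_def fun_eq_iff)
  ultimately show ?thesis by (simp add: std_gens_def)
qed

lemma card_std_gens: "card std_gens = 4"
proof -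
  have "real (card std_gens) = 4" using sum_std_gens[of "\<lambda>s. 1"] by simp
  then show ?thesis by linarith
qed

lemma word_eval_cursor: "word_eval wreath_ZZ (replicate k (cursor_move s)) = cursor_move (int k * s)"
proof (induction k)
  case (Suc k)
  then show ?case
    by (simp add: cursor_move_def mult_wreath algebra_simps)
qed (simp add: cursor_move_def one_wreath)

lemma word_eval_lamp: "word_eval wreath_ZZ (replicate k (lamp_change e)) = lamp_change (int k * e)"
proof (induction k)
  case (Suc k)
  then show ?case
    by (auto simp: lamp_change_def mult_wreath algebra_simps)
qed (auto simp: lamp_change_def one_wreath)

lemma cursor_word:
  "\<exists>ws. set ws \<subseteq> std_gens \<and> word_eval wreath_ZZ ws = cursor_move s \<and> length ws = nat \<bar>s\<bar>"
proof (intro exI conjI)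
  let ?ws = "replicate (nat \<bar>s\<bar>) (cursor_move (sgn s))"
  show "set ?ws \<subseteq> std_gens" by (auto simp: std_gens_def sgn_if)
  show "word_eval wreath_ZZ ?ws = cursor_move s"
    by (simp add: word_eval_cursor abs_mult_sgn del: foldr_replicate)
qed simp

lemma lamp_word:
  "\<exists>ws. set ws \<subseteq> std_gens \<and> word_eval wreath_ZZ ws = lamp_change e \<and> length ws = nat \<bar>e\<bar>"
proof (intro exI conjI)
  let ?ws = "replicate (nat \<bar>e\<bar>) (lamp_change (sgn e))"
  show "set ?ws \<subseteq> std_gens" by (auto simp: std_gens_def sgn_if)
  show "word_eval wreath_ZZ ?ws = lamp_change e"
    by (simp add: word_eval_lamp abs_mult_sgn del: foldr_replicate)
qed simp

text \<open>Sweep the cursor once from left to right over the support, setting each lamp on the way.\<close>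

lemma sweep_word:
  assumes "\<And>z. f z \<noteq> 0 \<Longrightarrow> lo \<le> z \<and> z < lo + int n"
  shows "\<exists>ws. set ws \<subseteq> std_gens \<and> word_eval wreath_ZZ ws = (f, lo + int n) \<and>
    int (length ws) = \<bar>lo\<bar> + int n + (\<Sum>z\<in>{lo..<lo + int n}. \<bar>f z\<bar>)"
  using assms
proof (induction n arbitrary: f)
  case 0
  then have "f = (\<lambda>z. 0)" by fastforce
  then show ?case using cursor_word[of lo] by (auto simp: cursor_move_def)
next
  case (Suc n)
  let ?x = "lo + int n"
  let ?f = "f(?x := 0)"
  have "lo \<le> z \<and> z < lo + int n" if "?f z \<noteq> 0" for z
    using Suc.prems[of z] that by (auto split: if_splits)
  from Suc.IH[OF this] obtain us where us: "set us \<subseteq> std_gens" "word_eval wreath_ZZ us = (?f, ?x)"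
    "int (length us) = \<bar>lo\<bar> + int n + (\<Sum>z\<in>{lo..<?x}. \<bar>?f z\<bar>)" by blast
  obtain vs where vs: "set vs \<subseteq> std_gens" "word_eval wreath_ZZ vs = lamp_change (f ?x)"
    "length vs = nat \<bar>f ?x\<bar>" using lamp_word by blast
  have c: "set us \<subseteq> carrier wreath_ZZ" "set vs \<subseteq> carrier wreath_ZZ"
    using us vs std_gens_carrier by auto
  have "word_eval wreath_ZZ ((us @ vs) @ [cursor_move 1]) = (f, lo + int (Suc n))"
    using us vs c by (simp add: wr.word_eval_append mult_lamp_change mult_cursor_move del: foldr_append append_assoc)
  moreover have "set ((us @ vs) @ [cursor_move 1]) \<subseteq> std_gens"
    using us vs by (auto simp: std_gens_def)
  moreover have "int (length ((us @ vs) @ [cursor_move 1])) =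
      \<bar>lo\<bar> + int (Suc n) + (\<Sum>z\<in>{lo..<lo + int (Suc n)}. \<bar>f z\<bar>)"
  proof -
    have "{lo..<lo + int (Suc n)} = insert ?x {lo..<?x}" by auto
    moreover have "(\<Sum>z\<in>{lo..<?x}. \<bar>?f z\<bar>) = (\<Sum>z\<in>{lo..<?x}. \<bar>f z\<bar>)" by (intro sum.cong) auto
    ultimately show ?thesis using us vs by simp
  qed
  ultimately show ?case by blast
qed

text \<open>
  After the sweep, the cursor walks directly to its final position.
\<close>

lemma wreath_word:
  assumes "\<And>z. f z \<noteq> 0 \<Longrightarrow> lo \<le> z \<and> z < lo + int n"
  shows "\<exists>ws. set ws \<subseteq> std_gens \<and> word_eval wreath_ZZ ws = (f, x) \<and>
    int (length ws) = \<bar>lo\<bar> + int n + (\<Sum>z\<in>{lo..<lo + int n}. \<bar>f z\<bar>) + \<bar>x - lo - int n\<bar>"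
proof -
  obtain us where us: "set us \<subseteq> std_gens" "word_eval wreath_ZZ us = (f, lo + int n)"
    "int (length us) = \<bar>lo\<bar> + int n + (\<Sum>z\<in>{lo..<lo + int n}. \<bar>f z\<bar>)"
    using sweep_word[of f lo n] assms by blast
  obtain vs where vs: "set vs \<subseteq> std_gens" "word_eval wreath_ZZ vs = cursor_move (x - lo - int n)"
    "length vs = nat \<bar>x - lo - int n\<bar>" using cursor_word by blast
  have c: "set us \<subseteq> carrier wreath_ZZ" "set vs \<subseteq> carrier wreath_ZZ"
    using us vs std_gens_carrier by auto
  have "word_eval wreath_ZZ (us @ vs) = (f, x)"
    using us vs c by (simp add: wr.word_eval_append mult_cursor_move del: foldr_append)
  then show ?thesis using us vs by (intro exI[of _ "us @ vs"]) auto
qed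

lemma fin_supp_interval:
  assumes "fin_supp f"
  shows "\<exists>lo n. \<forall>z. f z \<noteq> 0 \<longrightarrow> lo \<le> z \<and> z < lo + int n"
proof -
  have fin: "finite (insert 0 {z. f z \<noteq> 0})" (is "finite ?X") using assms by simp
  show ?thesis
    using Min_le[OF fin] Max_ge[OF fin]
    by (intro exI[of _ "Min ?X"] exI[of _ "nat (Max ?X - Min ?X + 1)"]) fastforce
qed

lemma std_gens: "fin_sym_gen_set wreath_ZZ std_gens"
proof -
  have "p \<in> generate wreath_ZZ std_gens" if "p \<in> carrier wreath_ZZ" for p
  proof -
    have *: "word_eval wreath_ZZ ws \<in> generate wreath_ZZ std_gens" if "set ws \<subseteq> std_gens" for ws
      using that by (induction ws) (auto intro: generate.intros)
    obtain f x where p: "p = (f, x)" "fin_supp f" using \<open>p \<in> _\<close> by (rule wreath_carrierE)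
    obtain lo n where "\<And>z. f z \<noteq> 0 \<Longrightarrow> lo \<le> z \<and> z < lo + int n"
      using fin_supp_interval[OF p(2)] by blast
    then obtain ws where "set ws \<subseteq> std_gens" "word_eval wreath_ZZ ws = (f, x)"
      using wreath_word by blast
    then show ?thesis using * p by metis
  qed
  moreover have "m_inv wreath_ZZ ` std_gens = std_gens"
    by (auto simp: std_gens_def inv_cursor_move inv_lamp_change)
  ultimately show ?thesis
    using wr.generate_incl[OF std_gens_carrier] std_gens_carrier
    by (auto simp: fin_sym_gen_set_def std_gens_def)
qed

text \<open>
  The configurations with cursor, lamps and lamp values in \<open>{0..N}\<close>. Each of the standard generators
  leaves this set only from one extreme value of a single coordinate that otherwise ranges freely over
  \<open>N + 1\<close> values.
\<close>

definition folner_box :: "nat \<Rightarrow> ((int \<Rightarrow> int) \<times> int) set" where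
  "folner_box N = {(f, x). x \<in> {0..int N} \<and> (\<forall>z. f z \<in> {0..int N}) \<and> (\<forall>z. z \<notin> {0..int N} \<longrightarrow> f z = 0)}"

lemma mem_folner_box:
  "(f, x) \<in> folner_box N \<longleftrightarrow>
    x \<in> {0..int N} \<and> (\<forall>z. f z \<in> {0..int N}) \<and> (\<forall>z. z \<notin> {0..int N} \<longrightarrow> f z = 0)"
  by (simp add: folner_box_def)

lemma finite_folner_box: "finite (folner_box N)"
proof (rule finite_subset)
  show "folner_box N \<subseteq> {f. \<forall>z. (z \<in> {0..int N} \<longrightarrow> f z \<in> {0..int N}) \<and>
      (z \<notin> {0..int N} \<longrightarrow> f z = 0)} \<times> {0..int N}"
    unfolding folner_box_def by blast
  show "finite \<dots>" by (intro finite_cartesian_product finite_set_of_finite_funs) auto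
qed

lemma folner_box_nonempty: "folner_box N \<noteq> {}"
proof -
  have "(\<lambda>z. 0, 0) \<in> folner_box N" by (simp add: mem_folner_box)
  then show ?thesis by blast
qed

lemma folner_box_carrier: "folner_box N \<subseteq> carrier wreath_ZZ"
proof
  fix p assume "p \<in> folner_box N"
  then obtain f x where p: "p = (f, x)" "\<And>z. z \<notin> {0..int N} \<Longrightarrow> f z = 0"
    unfolding folner_box_def by blast
  then have "{z. f z \<noteq> 0} \<subseteq> {0..int N}" by blast
  then show "p \<in> carrier wreath_ZZ" using p finite_subset by (auto simp: carrier_wreath)
qed

text \<open>
  A boundary point has its cursor (for a cursor move) or the lamp under its cursor (for a lamp change) at
  a known extreme value. Overwriting this value injects the boundary times \<open>{0..N}\<close> into the box, which
  avoids computing the cardinalities.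
\<close>

lemma folner_box_boundary_card:
  assumes "s \<in> std_gens"
  shows "card {p \<in> folner_box N. p \<otimes>\<^bsub>wreath_ZZ\<^esub> s \<notin> folner_box N} * Suc N \<le> card (folner_box N)"
proof -
  let ?B = "{p \<in> folner_box N. p \<otimes>\<^bsub>wreath_ZZ\<^esub> s \<notin> folner_box N}"
  have "\<exists>h. inj_on h (?B \<times> {0..int N}) \<and> h ` (?B \<times> {0..int N}) \<subseteq> folner_box N"
  proof -
    consider e where "s = cursor_move e" "e = 1 \<or> e = -1" | e where "s = lamp_change e" "e = 1 \<or> e = -1"
      using assms by (auto simp: std_gens_def)
    then show ?thesis
    proof cases
      case 1
      define v where "v = (if e = 1 then int N else 0)"
      have v: "x = v" if B: "(f, x) \<in> ?B" for f x
      proof (rule ccontr)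
        assume ne: "x \<noteq> v"
        have f: "(f, x) \<in> folner_box N" using B by simp
        then have "x \<in> {0..int N}" by (simp only: mem_folner_box)
        then have "x + e \<in> {0..int N}" using 1(2) ne by (auto simp: v_def split: if_splits)
        then have "(f, x) \<otimes>\<^bsub>wreath_ZZ\<^esub> s \<in> folner_box N"
          using f unfolding 1(1) mult_cursor_move mem_folner_box by blast
        then show False using B by simp
      qed
      let ?h = "\<lambda>((f, x), y). (f, y)"
      have "inj_on ?h (?B \<times> {0..int N})"
      proof (rule inj_onI)
        fix a b assume *: "a \<in> ?B \<times> {0..int N}" "b \<in> ?B \<times> {0..int N}" and eq: "?h a = ?h b"
        obtain f x y g x' y' where ab: "a = ((f, x), y)" "b = ((g, x'), y')" by (metis surj_pair)
        have "x = v" "x' = v" using * v[of f x] v[of g x'] unfolding ab by simp_all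
        then show "a = b" using eq by (simp add: ab)
      qed
      moreover have "?h ` (?B \<times> {0..int N}) \<subseteq> folner_box N"
      proof clarify
        fix f x y assume "(f, x) \<in> folner_box N" "y \<in> {0..int N}"
        then show "(f, y) \<in> folner_box N" unfolding mem_folner_box by blast
      qed
      ultimately show ?thesis by blast
    next
      case 2
      define v where "v = (if e = 1 then int N else 0)"
      have upd: "(f(x := y), x) \<in> folner_box N" if "(f, x) \<in> folner_box N" "y \<in> {0..int N}" for f x y
        using that unfolding mem_folner_box by (metis fun_upd_apply)
      have v: "f x = v" if B: "(f, x) \<in> ?B" for f x
      proof (rule ccontr)
        assume ne: "f x \<noteq> v"
        have f: "(f, x) \<in> folner_box N" using B by simp
        then have "f x \<in> {0..int N}" by (simp only: mem_folner_box)
        then have "f x + e \<in> {0..int N}" using 2(2) ne by (auto simp: v_def split: if_splits)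
        then have "(f, x) \<otimes>\<^bsub>wreath_ZZ\<^esub> s \<in> folner_box N"
          using upd[OF f] unfolding 2(1) mult_lamp_change by blast
        then show False using B by simp
      qed
      let ?h = "\<lambda>((f, x), y). (f(x := y), x)"
      have "inj_on ?h (?B \<times> {0..int N})"
      proof (rule inj_onI)
        fix a b assume *: "a \<in> ?B \<times> {0..int N}" "b \<in> ?B \<times> {0..int N}" and eq: "?h a = ?h b"
        obtain f x y g x' y' where ab: "a = ((f, x), y)" "b = ((g, x'), y')" by (metis surj_pair)
        have x: "x = x'" and fg: "f(x := y) = g(x := y')" using eq by (auto simp: ab)
        have "f x = v" "g x = v" using * v[of f x] v[of g x'] x unfolding ab by simp_all
        then have "f = g" using fg by (metis fun_upd_idem_iff fun_upd_upd)
        moreover have "y = y'" using fg by (metis fun_upd_same)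
        ultimately show "a = b" using x by (simp add: ab)
      qed
      moreover have "?h ` (?B \<times> {0..int N}) \<subseteq> folner_box N"
        using upd by auto
      ultimately show ?thesis by blast
    qed
  qed
  then have "card (?B \<times> {0..int N}) \<le> card (folner_box N)"
    using card_inj_on_le finite_folner_box by blast
  moreover have "card {0..int N} = Suc N" by simp
  ultimately show ?thesis by (simp only: card_cartesian_product)
qed

lemma folner_wreath: "folner_group wreath_ZZ std_gens folner_box"
proof unfold_locales
  fix s assume s: "s \<in> std_gens"
  let ?b = "\<lambda>N. card {p \<in> folner_box N. p \<otimes>\<^bsub>wreath_ZZ\<^esub> s \<notin> folner_box N}"
  have "real (?b N) / real (card (folner_box N)) \<le> 1 / real (Suc N)" for N
  proof -
    have "real (?b N) * real (Suc N) \<le> real (card (folner_box N))"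
      using folner_box_boundary_card[OF s, of N] by (simp only: flip: of_nat_mult of_nat_le_iff)
    moreover have "real (card (folner_box N)) > 0" using finite_folner_box folner_box_nonempty by (simp add: card_gt_0_iff)
    ultimately show ?thesis by (simp add: field_simps)
  qed
  then show "(\<lambda>N. real (?b N) / real (card (folner_box N))) \<longlonglongrightarrow> 0"
    by (intro Lim_null_comparison[OF _ LIMSEQ_inverse_real_of_nat] always_eventually allI)
      (simp add: inverse_eq_divide)
qed (use std_gens finite_folner_box folner_box_nonempty folner_box_carrier in auto)

section \<open>Moments of simple random walk on the wreath product\<close>

text \<open>
  Meaningful for \<open>h 0 = 0\<close>, when it is the sum of \<open>h (f z)\<close> over all positions \<open>z\<close>.
\<close>

definition lamp_sum :: "(int \<Rightarrow> real) \<Rightarrow> (int \<Rightarrow> int) \<Rightarrow> real" where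
  "lamp_sum h f = (\<Sum>z | f z \<noteq> 0. h (f z))"

lemma lamp_sum_superset:
  assumes "h 0 = 0" "finite X" "{z. f z \<noteq> 0} \<subseteq> X"
  shows "lamp_sum h f = (\<Sum>z\<in>X. h (f z))"
  unfolding lamp_sum_def using assms by (intro sum.mono_neutral_left) auto

lemma lamp_sum_upd:
  assumes "h 0 = 0" "fin_supp f"
  shows "lamp_sum h (f(x := y)) = lamp_sum h f - h (f x) + h y"
proof -
  let ?X = "insert x {z. f z \<noteq> 0}"
  have X: "finite ?X" using assms by simp
  have "lamp_sum h f = h (f x) + (\<Sum>z\<in>?X - {x}. h (f z))"
    using X assms by (subst lamp_sum_superset[of h ?X]) (auto simp: sum.remove[of _ x])
  moreover have "lamp_sum h (f(x := y)) = h y + (\<Sum>z\<in>?X - {x}. h (f z))"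
    using X assms by (subst lamp_sum_superset[of h ?X]) (auto simp: sum.remove[of _ x] intro!: sum.cong)
  ultimately show ?thesis by simp
qed

lemma lamp_sum_shift: "lamp_sum h (\<lambda>z. f (z - s)) = lamp_sum h f"
  unfolding lamp_sum_def
  by (rule sum.reindex_bij_witness[of _ "\<lambda>z. z + s" "\<lambda>z. z - s"]) auto

lemma lamp_sum_mono: "(\<And>y. h y \<le> k y) \<Longrightarrow> lamp_sum h f \<le> lamp_sum k f"
  unfolding lamp_sum_def by (rule sum_mono)

lemma lamp_sum_lin: "lamp_sum (\<lambda>y. a * h y - b * k y) f = a * lamp_sum h f - b * lamp_sum k f"
  by (simp add: lamp_sum_def sum_subtractf sum_distrib_left)

lemma lamp_sum_zero [simp]: "lamp_sum h (\<lambda>z. 0) = 0"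
  by (simp add: lamp_sum_def)

text \<open>
  The expectation of \<open>\<phi>\<close> at the \<open>n\<close>-th step of simple random walk with the standard generators.
\<close>

definition walk_mean :: "nat \<Rightarrow> ((int \<Rightarrow> int) \<times> int \<Rightarrow> real) \<Rightarrow> real" where
  "walk_mean n \<phi> = (\<Sum>w\<in>words std_gens n. \<phi> (word_eval wreath_ZZ w)) / 4 ^ n"

lemma finite_std_gens [simp]: "finite std_gens"
  by (simp add: std_gens_def)

lemma walk_mean_0: "walk_mean 0 \<phi> = \<phi> (\<lambda>z. 0, 0)"
  by (simp add: walk_mean_def one_wreath)

lemma word_std_gens_carrier:
  "w \<in> words std_gens n \<Longrightarrow> word_eval wreath_ZZ w \<in> carrier wreath_ZZ"
  by (rule wr.words_closed[OF std_gens_carrier])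

lemma walk_mean_mono:
  assumes "\<And>f x. fin_supp f \<Longrightarrow> \<phi> (f, x) \<le> \<psi> (f, x)"
  shows "walk_mean n \<phi> \<le> walk_mean n \<psi>"
  unfolding walk_mean_def
  by (intro divide_right_mono sum_mono) (metis assms word_std_gens_carrier wreath_carrierE, simp)

lemma walk_mean_const: "walk_mean n (\<lambda>p. k) = k"
  by (simp add: walk_mean_def card_words card_std_gens)

lemma walk_mean_add: "walk_mean n (\<lambda>p. \<phi> p + \<psi> p) = walk_mean n \<phi> + walk_mean n \<psi>"
  by (simp add: walk_mean_def sum.distrib add_divide_distrib)

lemma walk_mean_diff: "walk_mean n (\<lambda>p. \<phi> p - \<psi> p) = walk_mean n \<phi> - walk_mean n \<psi>"
  by (simp add: walk_mean_def sum_subtractf diff_divide_distrib)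

lemma walk_mean_scale: "walk_mean n (\<lambda>p. k * \<phi> p) = k * walk_mean n \<phi>"
  by (simp add: walk_mean_def sum_distrib_left)

text \<open>
  One step of the walk on the right changes the lamp under the cursor; here \<open>\<psi>\<close> is the discrete
  Laplacian of \<open>\<phi>\<close>.
\<close>

lemma walk_mean_append:
  assumes step: "\<And>f x. fin_supp f \<Longrightarrow> \<phi> (f, x + 1) + \<phi> (f, x - 1)
      + \<phi> (f(x := f x + 1), x) + \<phi> (f(x := f x - 1), x) = 4 * (\<phi> (f, x) + \<psi> (f, x))"
  shows "walk_mean (Suc n) \<phi> = walk_mean n \<phi> + walk_mean n \<psi>"
proof -
  have "(\<Sum>s\<in>std_gens. \<phi> (word_eval wreath_ZZ (w @ [s])))
      = 4 * (\<phi> (word_eval wreath_ZZ w) + \<psi> (word_eval wreath_ZZ w))"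
    if w: "w \<in> words std_gens n" for w
  proof -
    obtain f x where p: "word_eval wreath_ZZ w = (f, x)" "fin_supp f"
      using word_std_gens_carrier[OF w] by (rule wreath_carrierE)
    have wc: "set w \<subseteq> carrier wreath_ZZ" using w std_gens_carrier by (auto simp: words_def)
    have "word_eval wreath_ZZ (w @ [s]) = (f, x) \<otimes>\<^bsub>wreath_ZZ\<^esub> s" if "s \<in> std_gens" for s
      using that std_gens_carrier wc p by (subst wr.word_eval_append) auto
    then have "(\<Sum>s\<in>std_gens. \<phi> (word_eval wreath_ZZ (w @ [s])))
        = (\<Sum>s\<in>std_gens. \<phi> ((f, x) \<otimes>\<^bsub>wreath_ZZ\<^esub> s))" by simp
    also have "\<dots> = 4 * (\<phi> (f, x) + \<psi> (f, x))"
      using step[OF p(2), of x] by (simp add: sum_std_gens mult_cursor_move mult_lamp_change)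
    finally show ?thesis by (simp only: p)
  qed
  then have "(\<Sum>w\<in>words std_gens (n + 1). \<phi> (word_eval wreath_ZZ w))
      = (\<Sum>w\<in>words std_gens n. 4 * (\<phi> (word_eval wreath_ZZ w) + \<psi> (word_eval wreath_ZZ w)))"
    unfolding sum_words_add sum_words_1 by (intro sum.cong refl) blast
  then show ?thesis
    unfolding walk_mean_def by (simp add: add_divide_distrib sum.distrib flip: sum_distrib_left)
qed

text \<open>
  Adding the new step on the left gives the same distribution, but now the lamp that changes is always the
  one at the origin.
\<close>

lemma walk_mean_prepend:
  assumes step: "\<And>f x. fin_supp f \<Longrightarrow> \<phi> (\<lambda>z. f (z - 1), 1 + x) + \<phi> (\<lambda>z. f (z + 1), x - 1)
      + \<phi> (f(0 := f 0 + 1), x) + \<phi> (f(0 := f 0 - 1), x) = 4 * (\<phi> (f, x) + \<psi> (f, x))"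
  shows "walk_mean (Suc n) \<phi> = walk_mean n \<phi> + walk_mean n \<psi>"
proof -
  have "(\<Sum>s\<in>std_gens. \<phi> (word_eval wreath_ZZ ([s] @ w)))
      = 4 * (\<phi> (word_eval wreath_ZZ w) + \<psi> (word_eval wreath_ZZ w))"
    if w: "w \<in> words std_gens n" for w
  proof -
    obtain f x where p: "word_eval wreath_ZZ w = (f, x)" "fin_supp f"
      using word_std_gens_carrier[OF w] by (rule wreath_carrierE)
    have "(\<Sum>s\<in>std_gens. \<phi> (word_eval wreath_ZZ ([s] @ w)))
        = (\<Sum>s\<in>std_gens. \<phi> (s \<otimes>\<^bsub>wreath_ZZ\<^esub> (f, x)))" by (simp add: p)
    also have "\<dots> = 4 * (\<phi> (f, x) + \<psi> (f, x))"
      using step[OF p(2), of x]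
      by (simp add: sum_std_gens cursor_move_mult lamp_change_mult add.commute)
    finally show ?thesis by (simp only: p)
  qed
  then have "(\<Sum>w\<in>words std_gens n. \<Sum>s\<in>std_gens. \<phi> (word_eval wreath_ZZ ([s] @ w)))
      = (\<Sum>w\<in>words std_gens n. 4 * (\<phi> (word_eval wreath_ZZ w) + \<psi> (word_eval wreath_ZZ w)))"
    by (intro sum.cong refl) blast
  moreover have "(\<Sum>w\<in>words std_gens (1 + n). \<phi> (word_eval wreath_ZZ w))
      = (\<Sum>w\<in>words std_gens n. \<Sum>s\<in>std_gens. \<phi> (word_eval wreath_ZZ ([s] @ w)))"
    unfolding sum_words_add sum_words_1 by (rule sum.swap)
  ultimately show ?thesis
    unfolding walk_mean_def by (simp add: add_divide_distrib sum.distrib flip: sum_distrib_left)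
qed

lemma walk_mean_lamps_square:
  "walk_mean n (\<lambda>(f, x). lamp_sum (\<lambda>y. (real_of_int y)\<^sup>2) f) = real n / 2"
proof (induction n)
  case 0
  show ?case by (simp add: walk_mean_0)
next
  case (Suc n)
  have "walk_mean (Suc n) (\<lambda>(f, x). lamp_sum (\<lambda>y. (real_of_int y)\<^sup>2) f)
      = walk_mean n (\<lambda>(f, x). lamp_sum (\<lambda>y. (real_of_int y)\<^sup>2) f) + walk_mean n (\<lambda>p. 1 / 2)"
    by (rule walk_mean_append) (simp add: lamp_sum_upd power2_eq_square algebra_simps)
  then show ?case by (simp add: Suc walk_mean_const field_simps)
qed

lemma walk_mean_cursor_square: "walk_mean n (\<lambda>(f, x). (real_of_int x)\<^sup>2) = real n / 2"
proof (induction n)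
  case 0
  show ?case by (simp add: walk_mean_0)
next
  case (Suc n)
  have "walk_mean (Suc n) (\<lambda>(f, x). (real_of_int x)\<^sup>2)
      = walk_mean n (\<lambda>(f, x). (real_of_int x)\<^sup>2) + walk_mean n (\<lambda>p. 1 / 2)"
    by (rule walk_mean_append) (simp add: power2_eq_square algebra_simps)
  then show ?case by (simp add: Suc walk_mean_const field_simps)
qed

text \<open>
  A discrete Tanaka formula: \<open>(f 0)\<^sup>2\<close> and \<open>\<bar>x\<bar>\<close> both increase, on average, by the same amount
  exactly when the walk is at the origin. This controls the expected local time without estimating
  return probabilities.
\<close>

lemma walk_mean_origin_lamp:
  "walk_mean n (\<lambda>(f, x). (real_of_int (f 0))\<^sup>2) = walk_mean n (\<lambda>(f, x). \<bar>real_of_int x\<bar>)"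
proof -
  let ?\<phi> = "\<lambda>(f :: int \<Rightarrow> int, x). (real_of_int (f 0))\<^sup>2 - \<bar>real_of_int x\<bar>"
  have "walk_mean n ?\<phi> = 0"
  proof (induction n)
    case 0
    show ?case by (simp add: walk_mean_0)
  next
    case (Suc n)
    have "walk_mean (Suc n) ?\<phi> = walk_mean n ?\<phi> + walk_mean n (\<lambda>p. 0)"
    proof (rule walk_mean_append)
      fix f :: "int \<Rightarrow> int" and x :: int
      \<comment> \<open>The absolute value is harmonic except at the origin.\<close>
      have "\<bar>real_of_int (x + 1)\<bar> + \<bar>real_of_int (x - 1)\<bar> = 2 * \<bar>real_of_int x\<bar> + (if x = 0 then 2 else 0)"
        by (simp add: abs_if)
      then show "?\<phi> (f, x + 1) + ?\<phi> (f, x - 1) + ?\<phi> (f(x := f x + 1), x) + ?\<phi> (f(x := f x - 1), x)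
          = 4 * (?\<phi> (f, x) + 0)"
        by (simp add: power2_eq_square algebra_simps)
    qed
    then show ?case by (simp add: Suc walk_mean_const)
  qed
  then show ?thesis by (simp add: case_prod_unfold walk_mean_diff)
qed

lemma walk_mean_origin_lamp_le:
  "walk_mean n (\<lambda>(f, x). (real_of_int (f 0))\<^sup>2) \<le> sqrt (real n)"
proof (cases "n = 0")
  case True
  then show ?thesis by (simp add: walk_mean_0)
next
  case False
  define r where "r = sqrt (real n)"
  have r: "r > 0" "r * r = real n" using False by (auto simp: r_def)
  have "\<bar>real_of_int x\<bar> \<le> (1 / (2 * r)) * (real_of_int x)\<^sup>2 + r / 2" for x
  proof -
    have "0 \<le> (\<bar>real_of_int x\<bar> - r)\<^sup>2" by simp
    then have "2 * r * \<bar>real_of_int x\<bar> \<le> (real_of_int x)\<^sup>2 + r * r"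
      by (simp add: power2_eq_square algebra_simps abs_mult_self_eq)
    then show ?thesis using r(1) by (simp add: field_simps)
  qed
  then have "walk_mean n (\<lambda>(f, x). \<bar>real_of_int x\<bar>)
      \<le> walk_mean n (\<lambda>p. (1 / (2 * r)) * (case p of (f, x) \<Rightarrow> (real_of_int x)\<^sup>2) + r / 2)"
    by (intro walk_mean_mono) auto
  also have "\<dots> = (1 / (2 * r)) * (real n / 2) + r / 2"
    by (simp only: walk_mean_add walk_mean_scale walk_mean_const walk_mean_cursor_square)
  also have "\<dots> = 3 / 4 * r" using r by (simp add: field_simps flip: r(2))
  also have "\<dots> \<le> r" using r by simp
  finally show ?thesis by (simp add: walk_mean_origin_lamp r_def)
qed

text \<open>
  Adding steps on the left, only the lamp at the origin changes, and
  \<open>(a + 1)^4 + (a - 1)^4 = 2 a^4 + 12 a\<^sup>2 + 2\<close>. So the growth of the fourth moment is governed by the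
  second moment of the lamp at the origin, which is at most \<open>sqrt n\<close>.
\<close>

lemma walk_mean_lamps_fourth:
  "walk_mean n (\<lambda>(f, x). lamp_sum (\<lambda>y. real_of_int y ^ 4) f) \<le> 4 * real n * sqrt (real n)"
proof (induction n)
  case 0
  show ?case by (simp add: walk_mean_0)
next
  case (Suc n)
  let ?\<phi> = "\<lambda>(f, x). lamp_sum (\<lambda>y. real_of_int y ^ 4) f"
  let ?o = "\<lambda>(f :: int \<Rightarrow> int, x :: int). (real_of_int (f 0))\<^sup>2"
  have fourth: "(a + 1) ^ 4 + (a - 1) ^ 4 = 2 * a ^ 4 + 12 * a\<^sup>2 + (2::real)" for a
    by (simp add: power4_eq_xxxx power2_eq_square algebra_simps)
  have "walk_mean (Suc n) ?\<phi> = walk_mean n ?\<phi> + walk_mean n (\<lambda>p. 3 * ?o p + 1 / 2)"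
  proof (rule walk_mean_prepend)
    fix f :: "int \<Rightarrow> int" and x :: int
    assume f: "fin_supp f"
    show "?\<phi> (\<lambda>z. f (z - 1), 1 + x) + ?\<phi> (\<lambda>z. f (z + 1), x - 1) + ?\<phi> (f(0 := f 0 + 1), x)
      + ?\<phi> (f(0 := f 0 - 1), x) = 4 * (?\<phi> (f, x) + (3 * ?o (f, x) + 1 / 2))"
      using f fourth[of "real_of_int (f 0)"] lamp_sum_shift[of "\<lambda>y. real_of_int y ^ 4" f "-1"]
      by (simp add: lamp_sum_upd lamp_sum_shift)
  qed
  also have "\<dots> = walk_mean n ?\<phi> + (3 * walk_mean n ?o + 1 / 2)"
    by (simp only: walk_mean_add walk_mean_scale walk_mean_const)
  also have "\<dots> \<le> 4 * real n * sqrt (real n) + (3 * sqrt (real n) + 1 / 2)"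
    using Suc walk_mean_origin_lamp_le[of n] by linarith
  also have "\<dots> \<le> 4 * real n * sqrt (real (Suc n)) + (3 * sqrt (real (Suc n)) + sqrt (real (Suc n)))"
  proof -
    have "sqrt (real n) \<le> sqrt (real (Suc n))" "1 \<le> sqrt (real (Suc n))" by auto
    moreover from this have "4 * real n * sqrt (real n) \<le> 4 * real n * sqrt (real (Suc n))"
      by (intro mult_left_mono) auto
    ultimately show ?thesis by linarith
  qed
  also have "\<dots> = 4 * real (Suc n) * sqrt (real (Suc n))" by (simp add: algebra_simps)
  finally show ?case .
qed

text \<open>
  The second and fourth moments give a lower bound for the first one, by summing the pointwise inequality
  \<open>\<bar>y\<bar> \<ge> y\<^sup>2 / T - y^4 / T^3\<close> over all lamps; \<open>T = 4 n powr (1/4)\<close> is the typical size of a lamp, with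
  the factor 4 chosen such that the negative term does not win.
\<close>

lemma walk_mean_lamps_abs:
  "real n powr (3 / 4) / 16 \<le> walk_mean n (\<lambda>(f, x). lamp_sum (\<lambda>y. \<bar>real_of_int y\<bar>) f)"
proof (cases "n = 0")
  case True
  then show ?thesis by (simp add: walk_mean_0)
next
  case False
  define q where "q = real n powr (1 / 4)"
  have q: "q > 0" using False by (simp add: q_def)
  have q2: "q ^ 2 = sqrt (real n)" and q3: "q ^ 3 = real n powr (3 / 4)" and q4: "q ^ 4 = real n"
    using False by (simp_all add: q_def powr_powr powr_half_sqrt flip: powr_realpow)
  define T where "T = 4 * q"
  have T: "T > 0" using q by (simp add: T_def)
  have pt: "1 / T * (real_of_int y)\<^sup>2 - 1 / T ^ 3 * real_of_int y ^ 4 \<le> \<bar>real_of_int y\<bar>" for y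
  proof -
    define u where "u = \<bar>real_of_int y\<bar> / T"
    have u: "u \<ge> 0" and yu: "\<bar>real_of_int y\<bar> = T * u" using T by (auto simp: u_def)
    have "u * u - u ^ 4 \<le> u"
    proof (cases "u \<le> 1")
      case True
      then have "u * u \<le> u" using u by (simp add: mult_left_le)
      then show ?thesis using u by (smt (verit) zero_le_power)
    next
      case False
      then have "u ^ 2 \<le> u ^ 4" by (intro power_increasing) auto
      then show ?thesis using u by (simp add: power2_eq_square)
    qed
    then have "T * (u * u - u ^ 4) \<le> T * u" using T by (intro mult_left_mono) auto
    moreover have "(real_of_int y)\<^sup>2 = (T * u) ^ 2" "real_of_int y ^ 4 = (T * u) ^ 4"
      by (metis yu power2_abs, metis yu power_even_abs even_numeral)
    ultimately show ?thesis using T yu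
      by (simp add: power_mult_distrib field_simps power2_eq_square power3_eq_cube power4_eq_xxxx)
  qed
  let ?S2 = "\<lambda>(f :: int \<Rightarrow> int, x :: int). lamp_sum (\<lambda>y. (real_of_int y)\<^sup>2) f"
  let ?S4 = "\<lambda>(f :: int \<Rightarrow> int, x :: int). lamp_sum (\<lambda>y. real_of_int y ^ 4) f"
  have "q ^ 3 / 16 = 1 / T * (q ^ 4 / 2) - 1 / T ^ 3 * (4 * q ^ 4 * q ^ 2)"
    using q by (simp add: T_def field_simps power2_eq_square power3_eq_cube power4_eq_xxxx)
  also have "\<dots> \<le> 1 / T * walk_mean n ?S2 - 1 / T ^ 3 * walk_mean n ?S4"
    using walk_mean_lamps_square[of n] walk_mean_lamps_fourth[of n] T
    unfolding q2 q4 by (intro diff_mono mult_left_mono) auto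
  also have "\<dots> = walk_mean n (\<lambda>p. 1 / T * ?S2 p - 1 / T ^ 3 * ?S4 p)"
    by (simp only: walk_mean_diff walk_mean_scale)
  also have "\<dots> \<le> walk_mean n (\<lambda>(f, x). lamp_sum (\<lambda>y. \<bar>real_of_int y\<bar>) f)"
    unfolding prod.case lamp_sum_lin[symmetric]
    by (intro walk_mean_mono) (simp only: prod.case lamp_sum_lin[symmetric], rule lamp_sum_mono, rule pt)
  finally show ?thesis by (simp only: q3)
qed

lemma lamp_sum_le_word_dist:
  assumes "(f, x) \<in> carrier wreath_ZZ"
  shows "lamp_sum (\<lambda>y. \<bar>real_of_int y\<bar>) f \<le> real (word_dist wreath_ZZ std_gens \<one>\<^bsub>wreath_ZZ\<^esub> (f, x))"
proof -
  let ?l = "\<lambda>p. lamp_sum (\<lambda>y. \<bar>real_of_int y\<bar>) (fst p)"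
  have *: "?l (word_eval wreath_ZZ ws) \<le> real (length ws)" if "set ws \<subseteq> std_gens" for ws
    using that
  proof (induction ws)
    case Nil
    then show ?case by (simp add: one_wreath)
  next
    case (Cons s ws)
    have "set ws \<subseteq> carrier wreath_ZZ" using Cons.prems std_gens_carrier by auto
    then obtain g y where p: "word_eval wreath_ZZ ws = (g, y)" "fin_supp g"
      using wr.word_eval_closed by (metis wreath_carrierE)
    have s: "s \<in> std_gens" using Cons.prems by simp
    have "?l (s \<otimes>\<^bsub>wreath_ZZ\<^esub> (g, y)) \<le> 1 + ?l (g, y)"
      using s p(2) lamp_sum_shift[of "\<lambda>y. \<bar>real_of_int y\<bar>" g "-1"]
      by (auto simp: std_gens_def cursor_move_mult lamp_change_mult lamp_sum_shift lamp_sum_upd)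
    then show ?case using Cons p by simp
  qed
  obtain ws where ws: "length ws = word_dist wreath_ZZ std_gens \<one>\<^bsub>wreath_ZZ\<^esub> (f, x)" "set ws \<subseteq> std_gens"
    "inv\<^bsub>wreath_ZZ\<^esub> \<one>\<^bsub>wreath_ZZ\<^esub> \<otimes>\<^bsub>wreath_ZZ\<^esub> (f, x) = word_eval wreath_ZZ ws"
    using wr.word_dist_word[OF std_gens wr.one_closed assms] by blast
  then have "word_eval wreath_ZZ ws = (f, x)" using assms by simp
  then show ?thesis using *[OF ws(2)] ws(1) by simp
qed

text \<open>
  With \<open>p = 2\<alpha>\<close>, the random walk bound gives \<open>E d(1, W\<^sub>n) powr p = O(n)\<close>, while the moment
  estimate makes the left-hand side at least of order \<open>n powr (3 p / 4)\<close>. In place of Jensen's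
  inequality, the proof uses \<open>Y powr p \<ge> l powr (p - 1) * (Y - l)\<close> with \<open>l\<close> half of the lower bound for
  the mean of \<open>Y\<close>.
\<close>

lemma compression_upper_bound:
  assumes adm: "compression_admissible wreath_ZZ std_gens \<alpha>"
  shows "\<alpha> \<le> 2 / 3"
proof (rule ccontr)
  assume "\<not> \<alpha> \<le> 2 / 3"
  then have \<alpha>: "\<alpha> > 2 / 3" by simp
  define p where "p = 2 * \<alpha>"
  have p: "p > 4 / 3" using \<alpha> by (simp add: p_def)
  let ?d = "\<lambda>g. real (word_dist wreath_ZZ std_gens \<one>\<^bsub>wreath_ZZ\<^esub> g)"
  let ?Y = "\<lambda>(f :: int \<Rightarrow> int, x :: int). lamp_sum (\<lambda>y. \<bar>real_of_int y\<bar>) f"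
  obtain c where c: "c > 0" and bound: "\<And>k. c * (\<Sum>w\<in>words std_gens (2 ^ k).
      ?d (word_eval wreath_ZZ w) powr p) \<le> 2 ^ k * 4 ^ (2 ^ k)"
    using folner_group.random_walk_compression_bound[OF folner_wreath adm]
    unfolding p_def card_std_gens by auto
  have "c * (2 powr (3 * p / 4 - 1)) ^ k \<le> 32 powr p" for k
  proof -
    define n :: nat where "n = 2 ^ k"
    have n: "real n > 0" by (simp add: n_def)
    define l where "l = real n powr (3 / 4) / 32"
    have l: "l > 0" using n by (simp add: l_def)
    have "l powr p = l powr (p - 1) * l" using l by (simp add: powr_diff)
    also have "\<dots> \<le> l powr (p - 1) * (walk_mean n ?Y - l)"
      using walk_mean_lamps_abs[of n] by (intro mult_left_mono) (auto simp: l_def)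
    also have "\<dots> = walk_mean n (\<lambda>g. l powr (p - 1) * (?Y g - l))"
      by (simp only: walk_mean_diff walk_mean_scale walk_mean_const)
    also have "\<dots> \<le> walk_mean n (\<lambda>g. ?d g powr p)"
    proof (rule walk_mean_mono)
      fix f :: "int \<Rightarrow> int" and x :: int assume f: "fin_supp f"
      define Y where "Y = ?Y (f, x)"
      have Yd: "Y \<le> ?d (f, x)" using lamp_sum_le_word_dist[of f x] f by (simp add: Y_def carrier_wreath)
      show "l powr (p - 1) * (?Y (f, x) - l) \<le> ?d (f, x) powr p"
      proof (cases "Y \<le> l")
        case True
        then have "l powr (p - 1) * (Y - l) \<le> 0" by (simp add: mult_nonneg_nonpos)
        then show ?thesis unfolding Y_def using powr_ge_zero order_trans by blast
      next
        case False
        then have "l powr (p - 1) * (Y - l) \<le> Y powr (p - 1) * Y"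
          using l p by (intro mult_mono powr_mono2) auto
        also have "\<dots> = Y powr p" using False l by (simp add: powr_diff)
        also have "\<dots> \<le> ?d (f, x) powr p" using False l p Yd by (intro powr_mono2) auto
        finally show ?thesis by (simp add: Y_def)
      qed
    qed
    finally have "c * l powr p \<le> c * walk_mean n (\<lambda>g. ?d g powr p)" using c by simp
    also have "\<dots> \<le> real n"
      using divide_right_mono[OF bound[of k], of "4 ^ (2 ^ k)"] unfolding walk_mean_def n_def by simp
    finally have "c * l powr p \<le> real n" .
    moreover have "l powr p = real n powr (3 * p / 4) / 32 powr p"
      using n by (simp add: l_def powr_divide powr_powr mult.commute)
    ultimately have "c * real n powr (3 * p / 4) \<le> 32 powr p * real n"
      by (simp add: divide_le_eq mult.commute)
    moreover have "real n powr (3 * p / 4) = real n powr (3 * p / 4 - 1) * real n"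
      using n by (simp add: powr_diff)
    ultimately have "c * real n powr (3 * p / 4 - 1) \<le> 32 powr p" using n by simp
    moreover have "real n powr (3 * p / 4 - 1) = (2 powr (3 * p / 4 - 1)) ^ k"
      by (simp add: n_def powr_powr mult.commute flip: powr_realpow)
    ultimately show ?thesis by simp
  qed
  moreover obtain k where "32 powr p / c < (2 powr (3 * p / 4 - 1)) ^ k"
    using real_arch_pow[of "2 powr (3 * p / 4 - 1)" "32 powr p / c"] p
    by (auto simp: gr_one_powr)
  ultimately show False using c by (metis less_divide_eq mult.commute not_le pos_divide_less_eq)
qed

section \<open>Finitely supported vectors inside square-integrable functions\<close>

text \<open>
  Disjoint intervals of positive length in \<open>[0, 1]\<close>; their normalized indicator functions are an
  orthonormal sequence.
\<close>

definition block :: "nat \<Rightarrow> real set" where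
  "block n = {1 / real (n + 2)<..1 / real (n + 1)}"

definition block_fun :: "nat \<Rightarrow> real \<Rightarrow> real" where
  "block_fun n t = sqrt (real (n + 1) * real (n + 2)) * indicator (block n) t"

lemma block_disjoint: "m \<noteq> n \<Longrightarrow> block m \<inter> block n = {}"
proof -
  have *: "block m \<inter> block n = {}" if "m < n" for m n
  proof -
    have "1 / real (n + 1) \<le> 1 / real (m + 2)" using that by (intro divide_left_mono) auto
    then show ?thesis by (auto simp: block_def)
  qed
  show "m \<noteq> n \<Longrightarrow> block m \<inter> block n = {}"
    using *[of m n] *[of n m] by (auto simp: Int_commute neq_iff)
qed

lemma block_fun_mult:
  "block_fun m t * block_fun n t = (if m = n then real (n + 1) * real (n + 2) * indicator (block n) t else 0)"
proof (cases "m = n")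
  case True
  then show ?thesis by (simp add: block_fun_def indicator_def)
next
  case False
  then show ?thesis using block_disjoint[of m n] by (auto simp: block_fun_def indicator_def)
qed

lemma block_integral:
  "integrable unit_interval_measure (indicator (block n) :: real \<Rightarrow> real)"
  "(LINT t|unit_interval_measure. (indicator (block n) t :: real)) = 1 / (real (n + 1) * real (n + 2))"
proof -
  have le: "1 / real (n + 2) \<le> 1 / real (n + 1)" by (simp add: frac_le)
  have "1 / real (n + 1) \<le> 1" by simp
  then have sub: "block n \<subseteq> {0..1}" unfolding block_def
    by (smt (verit, best) atLeastAtMost_iff greaterThanAtMost_iff of_nat_0_le_iff subsetI zero_le_divide_1_iff)
  have sets: "block n \<in> sets unit_interval_measure"
    using sub by (simp add: sets_restrict_space_iff) (simp add: block_def)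
  have m: "emeasure unit_interval_measure (block n) = ennreal (1 / real (n + 1) - 1 / real (n + 2))"
    using sub le by (simp add: emeasure_restrict_space) (simp add: block_def emeasure_lborel_Ioc)
  have "has_bochner_integral unit_interval_measure (indicator (block n) :: real \<Rightarrow> real) (measure unit_interval_measure (block n))"
    using m by (intro has_bochner_integral_real_indicator sets) simp
  moreover have "measure unit_interval_measure (block n) = 1 / real (n + 1) - 1 / real (n + 2)"
    using m le by (simp add: measure_def del: of_nat_add)
  moreover have "\<dots> = 1 / (real (n + 1) * real (n + 2))" by (simp add: field_simps)
  ultimately show "integrable unit_interval_measure (indicator (block n) :: real \<Rightarrow> real)"
    "(LINT t|unit_interval_measure. (indicator (block n) t :: real)) = 1 / (real (n + 1) * real (n + 2))"
    by (auto simp: has_bochner_integral_iff)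
qed

lemma block_fun_orthonormal:
  "integrable unit_interval_measure (\<lambda>t. block_fun m t * block_fun n t)"
  "(LINT t|unit_interval_measure. block_fun m t * block_fun n t) = (if m = n then 1 else 0)"
proof -
  have "integrable unit_interval_measure (\<lambda>t. real (n + 1) * real (n + 2) * indicator (block n) t)"
    by (intro integrable_mult_right block_integral)
  then show "integrable unit_interval_measure (\<lambda>t. block_fun m t * block_fun n t)"
    unfolding block_fun_mult by (cases "m = n") simp_all
  have "(LINT t|unit_interval_measure. real (n + 1) * real (n + 2) * indicator (block n) t) = 1"
    by (simp only: integral_mult_right_zero block_integral) simp
  then show "(LINT t|unit_interval_measure. block_fun m t * block_fun n t) = (if m = n then 1 else 0)"
    unfolding block_fun_mult by (cases "m = n") simp_all
qed

lemma block_sum_norm: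
  assumes J: "finite J" and inj: "inj_on e J"
  shows "(\<lambda>t. \<Sum>i\<in>J. a i * block_fun (e i) t) \<in> L2_space"
    and "(LINT t|unit_interval_measure. (\<Sum>i\<in>J. a i * block_fun (e i) t)\<^sup>2) = (\<Sum>i\<in>J. (a i)\<^sup>2)"
proof -
  have sq: "(\<Sum>i\<in>J. a i * block_fun (e i) t)\<^sup>2
      = (\<Sum>i\<in>J. \<Sum>j\<in>J. (a i * a j) * (block_fun (e i) t * block_fun (e j) t))" for t
    by (simp add: power2_eq_square sum_product mult_ac)
  have meas: "block_fun n \<in> borel_measurable unit_interval_measure" for n
    unfolding block_fun_def using borel_measurable_integrable[OF block_integral(1)[of n]] by measurable
  have int: "integrable unit_interval_measure (\<lambda>t. (\<Sum>i\<in>J. a i * block_fun (e i) t)\<^sup>2)"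
    unfolding sq by (intro Bochner_Integration.integrable_sum integrable_mult_right block_fun_orthonormal)
  moreover have "(\<lambda>t. \<Sum>i\<in>J. a i * block_fun (e i) t) \<in> borel_measurable unit_interval_measure"
    using meas by measurable
  ultimately show "(\<lambda>t. \<Sum>i\<in>J. a i * block_fun (e i) t) \<in> L2_space"
    by (simp add: L2_space_def)
  have "(LINT t|unit_interval_measure. (\<Sum>i\<in>J. a i * block_fun (e i) t)\<^sup>2)
      = (\<Sum>i\<in>J. \<Sum>j\<in>J. (a i * a j) * (if e i = e j then 1 else 0))"
    unfolding sq
    by (simp add: Bochner_Integration.integral_sum Bochner_Integration.integrable_sum block_fun_orthonormal
        del: mult_ac)
  also have "\<dots> = (\<Sum>i\<in>J. \<Sum>j\<in>J. if i = j then (a i)\<^sup>2 else 0)"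
    using inj by (intro sum.cong refl) (auto simp: power2_eq_square inj_on_def)
  also have "\<dots> = (\<Sum>i\<in>J. (a i)\<^sup>2)" using J by simp
  finally show "(LINT t|unit_interval_measure. (\<Sum>i\<in>J. a i * block_fun (e i) t)\<^sup>2) = (\<Sum>i\<in>J. (a i)\<^sup>2)" .
qed

text \<open>
  For finitely supported \<open>u\<close> and \<open>v\<close>, their distance in \<open>\<ell>\<^sub>2\<close>.
\<close>

definition l2_dist :: "('i \<Rightarrow> real) \<Rightarrow> ('i \<Rightarrow> real) \<Rightarrow> real" where
  "l2_dist u v = L2_set (\<lambda>i. u i - v i) {i. u i \<noteq> v i}"

lemma l2_dist_superset:
  assumes "finite X" "{i. u i \<noteq> v i} \<subseteq> X"
  shows "l2_dist u v = L2_set (\<lambda>i. u i - v i) X"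
proof -
  have "(\<Sum>i | u i \<noteq> v i. (u i - v i)\<^sup>2) = (\<Sum>i\<in>X. (u i - v i)\<^sup>2)"
    using assms by (intro sum.mono_neutral_left) auto
  then show ?thesis by (simp add: l2_dist_def L2_set_def)
qed

lemma finite_differ:
  assumes "finite {i. u i \<noteq> (0::real)}" "finite {i. v i \<noteq> 0}"
  shows "finite {i. u i \<noteq> v i}"
  by (rule finite_subset[of _ "{i. u i \<noteq> 0} \<union> {i. v i \<noteq> 0}"]) (use assms in auto)

lemma l2_dist_ge:
  assumes "finite {i. u i \<noteq> 0}" "finite {i. v i \<noteq> 0}" "finite J"
  shows "(\<Sum>i\<in>J. (u i - v i)\<^sup>2) \<le> (l2_dist u v)\<^sup>2"
proof -
  let ?X = "J \<union> {i. u i \<noteq> v i}"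
  have X: "finite ?X" using assms finite_differ by auto
  have "(\<Sum>i\<in>J. (u i - v i)\<^sup>2) \<le> (\<Sum>i\<in>?X. (u i - v i)\<^sup>2)"
    using X by (intro sum_mono2) auto
  also have "\<dots> = (l2_dist u v)\<^sup>2"
    using X by (simp add: l2_dist_superset[of ?X] L2_set_def sum_nonneg)
  finally show ?thesis .
qed

lemma l2_dist_triangle:
  assumes "finite {i. u i \<noteq> 0}" "finite {i. v i \<noteq> 0}" "finite {i. w i \<noteq> 0}"
  shows "l2_dist u w \<le> l2_dist u v + l2_dist v w"
proof -
  let ?X = "{i. u i \<noteq> 0} \<union> {i. v i \<noteq> 0} \<union> {i. w i \<noteq> 0}"
  have X: "finite ?X" using assms by simp
  have "L2_set (\<lambda>i. (u i - v i) + (v i - w i)) ?X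
      \<le> L2_set (\<lambda>i. u i - v i) ?X + L2_set (\<lambda>i. v i - w i) ?X"
    by (rule L2_set_triangle_ineq)
  moreover have "l2_dist u w = L2_set (\<lambda>i. u i - w i) ?X" using X by (intro l2_dist_superset) auto
  moreover have "l2_dist u v = L2_set (\<lambda>i. u i - v i) ?X" using X by (intro l2_dist_superset) auto
  moreover have "l2_dist v w = L2_set (\<lambda>i. v i - w i) ?X" using X by (intro l2_dist_superset) auto
  ultimately show ?thesis by simp
qed

lemma l2_dist_commute: "l2_dist u v = l2_dist v u"
proof -
  have "{i. u i \<noteq> v i} = {i. v i \<noteq> u i}" by auto
  then show ?thesis by (simp add: l2_dist_def L2_set_def power2_commute)
qed

text \<open>
  Enumerating the countable index set sends the unit vectors to the orthonormal sequence \<open>block_fun\<close>.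
\<close>

lemma l2_realization:
  fixes V :: "'a \<Rightarrow> 'i \<Rightarrow> real"
  assumes I: "countable I" and supp: "\<And>x. x \<in> C \<Longrightarrow> {i. V x i \<noteq> 0} \<subseteq> I"
    and fin: "\<And>x. x \<in> C \<Longrightarrow> finite {i. V x i \<noteq> 0}"
  shows "\<exists>F. F \<in> C \<rightarrow> L2_space \<and> (\<forall>x\<in>C. \<forall>y\<in>C. L2_norm (\<lambda>t. F x t - F y t) = l2_dist (V x) (V y))"
proof -
  define e where "e = to_nat_on I"
  have inj: "inj_on e I" unfolding e_def by (rule inj_on_to_nat_on[OF I])
  define F where "F x t = (\<Sum>i | V x i \<noteq> 0. V x i * block_fun (e i) t)" for x t
  have Fx: "F x t = (\<Sum>i\<in>X. V x i * block_fun (e i) t)" if "finite X" "{i. V x i \<noteq> 0} \<subseteq> X" for x t X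
    unfolding F_def using that by (intro sum.mono_neutral_left) auto
  have "F x \<in> L2_space" if "x \<in> C" for x
    unfolding F_def using that fin inj_on_subset[OF inj supp] by (intro block_sum_norm) auto
  moreover have "L2_norm (\<lambda>t. F x t - F y t) = l2_dist (V x) (V y)" if "x \<in> C" "y \<in> C" for x y
  proof -
    let ?X = "{i. V x i \<noteq> 0} \<union> {i. V y i \<noteq> 0}"
    have X: "finite ?X" "?X \<subseteq> I" using fin supp that by auto
    have "F x t - F y t = (\<Sum>i\<in>?X. (V x i - V y i) * block_fun (e i) t)" for t
      using X(1) by (simp add: Fx[of ?X] sum_subtractf left_diff_distrib)
    then have "L2_norm (\<lambda>t. F x t - F y t) = sqrt (\<Sum>i\<in>?X. (V x i - V y i)\<^sup>2)"
      using block_sum_norm(2)[OF X(1) inj_on_subset[OF inj X(2)]] by (simp add: L2_norm_def)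
    also have "\<dots> = l2_dist (V x) (V y)"
      using X(1) by (subst l2_dist_superset[of ?X]) (auto simp: L2_set_def)
    finally show ?thesis .
  qed
  ultimately show ?thesis by blast
qed

section \<open>The embedding of the wreath product\<close>

text \<open>
  The increments are at most \<open>k powr (\<beta> - 1)\<close>, whose squares are summable exactly because
  \<open>\<beta> < 1/2\<close>. This makes the embedding Lipschitz along cursor moves.
\<close>

lemma powr_increment_summable:
  assumes \<beta>: "0 < \<beta>" "\<beta> < 1 / 2"
  shows "summable (\<lambda>k. (real (Suc k) powr \<beta> - real k powr \<beta>)\<^sup>2)"
proof (rule summable_comparison_test)
  show "summable (\<lambda>k. real k powr (2 * \<beta> - 2))"
    using \<beta> by (simp add: summable_real_powr_iff)
  have "(real (Suc k) powr \<beta> - real k powr \<beta>)\<^sup>2 \<le> real k powr (2 * \<beta> - 2)" if k: "k \<ge> 1" for k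
  proof -
    have k0: "real k > 0" using k by simp
    have "(1 + 1 / real k) powr \<beta> \<le> (1 + 1 / real k) powr 1"
      using \<beta> k0 by (intro powr_mono) auto
    then have "(1 + 1 / real k) powr \<beta> \<le> 1 + 1 / real k" using k0 by simp
    then have "real k powr \<beta> * (1 + 1 / real k) powr \<beta> \<le> real k powr \<beta> * (1 + 1 / real k)"
      by (intro mult_left_mono) auto
    moreover have "real k powr \<beta> * (1 + 1 / real k) powr \<beta> = real (Suc k) powr \<beta>"
    proof -
      have "real k * (1 + 1 / real k) = real (Suc k)" using k0 by (simp add: distrib_left)
      then show ?thesis using powr_mult[of "real k" "1 + 1 / real k" \<beta>] k0 by simp
    qed
    moreover have "real k powr \<beta> * (1 + 1 / real k) = real k powr \<beta> + real k powr (\<beta> - 1)"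
      using k0 by (simp add: powr_diff field_simps)
    ultimately have "real (Suc k) powr \<beta> - real k powr \<beta> \<le> real k powr (\<beta> - 1)" by linarith
    moreover have "0 \<le> real (Suc k) powr \<beta> - real k powr \<beta>"
      using \<beta> by (simp add: powr_mono2)
    ultimately have "(real (Suc k) powr \<beta> - real k powr \<beta>)\<^sup>2 \<le> (real k powr (\<beta> - 1))\<^sup>2"
      by (intro power_mono) auto
    also have "\<dots> = real k powr (2 * \<beta> - 2)"
      by (simp add: power2_eq_square flip: powr_add)
    finally show ?thesis .
  qed
  then show "\<exists>N. \<forall>k\<ge>N. norm ((real (Suc k) powr \<beta> - real k powr \<beta>)\<^sup>2) \<le> real k powr (2 * \<beta> - 2)"
    by (intro exI[of _ 1]) auto
qed

text \<open>
  For \<open>k \<le> K\<close>, \<open>k powr (2\<beta>) \<ge> k * K powr (2\<beta> - 1)\<close>, which reduces the estimate to the sum of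
  the first \<open>K\<close> integers.
\<close>

lemma powr_sum_ge:
  assumes \<beta>: "0 < \<beta>" "\<beta> < 1 / 2"
  shows "real K powr (2 * \<beta> + 1) / 2 \<le> (\<Sum>k=1..K. (real k powr \<beta>)\<^sup>2)"
proof (cases "K = 0")
  case False
  then have K: "real K > 0" by simp
  have "(\<Sum>k=1..K. real k) = real K * (real K + 1) / 2"
    by (induction K) (auto simp: field_simps)
  then have "real K ^ 2 / 2 \<le> (\<Sum>k=1..K. real k)" by (simp add: power2_eq_square field_simps)
  then have "real K powr (2 * \<beta> - 1) * (real K ^ 2 / 2) \<le> real K powr (2 * \<beta> - 1) * (\<Sum>k=1..K. real k)"
    by (intro mult_left_mono) auto
  also have "\<dots> = (\<Sum>k=1..K. real K powr (2 * \<beta> - 1) * real k)" by (rule sum_distrib_left)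
  also have "\<dots> \<le> (\<Sum>k=1..K. (real k powr \<beta>)\<^sup>2)"
  proof (rule sum_mono)
    fix k assume k: "k \<in> {1..K}"
    have "real K powr (2 * \<beta> - 1) * real k \<le> real k powr (2 * \<beta> - 1) * real k"
      using k \<beta> by (intro mult_right_mono powr_mono2') auto
    also have "\<dots> = (real k powr \<beta>)\<^sup>2"
      using k by (simp add: power2_eq_square powr_diff flip: powr_add)
    finally show "real K powr (2 * \<beta> - 1) * real k \<le> (real k powr \<beta>)\<^sup>2" .
  qed
  finally have "real K powr (2 * \<beta> - 1) * (real K ^ 2 / 2) \<le> (\<Sum>k=1..K. (real k powr \<beta>)\<^sup>2)" .
  moreover have "real K powr (2 * \<beta> - 1) * (real K ^ 2 / 2) = real K powr (2 * \<beta> + 1) / 2"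
    using K by (simp add: powr_diff powr_add power2_eq_square)
  ultimately show ?thesis by simp
qed simp

text \<open>
  The labels of an orthonormal basis. The set in a ray label is the graph of a restriction of the lamp
  configuration to a half-line, without the lamps that are off; so only countably many labels occur.
\<close>

datatype coord = Cursor | Lamp int | Right_Ray int "(int \<times> int) set" | Left_Ray int "(int \<times> int) set"

definition tail_graph :: "(int \<Rightarrow> int) \<Rightarrow> int \<Rightarrow> (int \<times> int) set" where
  "tail_graph f z = {(w, f w) | w. z \<le> w \<and> f w \<noteq> 0}"

text \<open>
  The coordinates of \<open>f\<close> with cursor \<open>x\<close> on the ray to the right of the cursor: position \<open>z\<close>
  contributes \<open>(z - x) powr \<beta>\<close> in the direction labelled by the lamps from \<open>z\<close> on. Leaving out the
  empty set of lamps makes the vector finitely supported; \<open>nat\<close> makes the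
  positions left of the cursor contribute \<open>0 powr \<beta> = 0\<close>.
\<close>

definition ray :: "real \<Rightarrow> (int \<Rightarrow> int) \<Rightarrow> int \<Rightarrow> int \<Rightarrow> (int \<times> int) set \<Rightarrow> real" where
  "ray \<beta> f x z T = (if T \<noteq> {} \<and> T = tail_graph f z then real (nat (z - x)) powr \<beta> else 0)"

primrec coords :: "real \<Rightarrow> (int \<Rightarrow> int) \<Rightarrow> int \<Rightarrow> coord \<Rightarrow> real" where
  "coords \<beta> f x Cursor = real_of_int x"
| "coords \<beta> f x (Lamp z) = real_of_int (f z)"
| "coords \<beta> f x (Right_Ray z T) = ray \<beta> f x z T"
| "coords \<beta> f x (Left_Ray z T) = ray \<beta> (\<lambda>w. f (- w)) (- x) z T"

lemma tail_graph_empty_iff: "tail_graph f z = {} \<longleftrightarrow> (\<forall>w\<ge>z. f w = 0)"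
  by (auto simp: tail_graph_def)

lemma tail_graph_eq_iff: "tail_graph f z = tail_graph g z \<longleftrightarrow> (\<forall>w\<ge>z. f w = g w)"
proof
  assume eq: "tail_graph f z = tail_graph g z"
  show "\<forall>w\<ge>z. f w = g w"
  proof (intro allI impI)
    fix w assume w: "z \<le> w"
    have "(w, f w) \<in> tail_graph g z \<or> f w = 0" using eq w by (auto simp: tail_graph_def)
    moreover have "(w, g w) \<in> tail_graph f z \<or> g w = 0" using eq w by (auto simp: tail_graph_def)
    ultimately show "f w = g w" by (auto simp: tail_graph_def)
  qed
qed (force simp: tail_graph_def)

lemma finite_tail_graph: "fin_supp f \<Longrightarrow> finite (tail_graph f z)"
  by (rule finite_subset[of _ "(\<lambda>w. (w, f w)) ` {w. f w \<noteq> 0}"]) (auto simp: tail_graph_def)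

lemma finite_ray_positions:
  assumes "fin_supp f"
  shows "finite {z. x < z \<and> tail_graph f z \<noteq> {}}"
  by (rule finite_subset[of _ "\<Union>w\<in>{w. f w \<noteq> 0}. {x..w}"])
    (use assms in \<open>auto simp: tail_graph_empty_iff\<close>)

lemma fin_supp_mirror: "fin_supp f \<Longrightarrow> fin_supp (\<lambda>w. f (- w))"
proof -
  assume f: "fin_supp f"
  have "{w. f (- w) \<noteq> 0} \<subseteq> uminus ` {w. f w \<noteq> 0}" by (auto simp: image_iff) (metis minus_minus)
  then show ?thesis using f finite_subset by blast
qed

lemma ray_nonzeroD: "ray \<beta> f x z T \<noteq> 0 \<Longrightarrow> x < z \<and> T = tail_graph f z \<and> tail_graph f z \<noteq> {}"
  by (auto simp: ray_def split: if_splits)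

definition coord_support :: "(int \<Rightarrow> int) \<Rightarrow> int \<Rightarrow> coord set" where
  "coord_support f x = insert Cursor (Lamp ` {z. f z \<noteq> 0} \<union>
    (\<lambda>z. Right_Ray z (tail_graph f z)) ` {z. x < z \<and> tail_graph f z \<noteq> {}} \<union>
    (\<lambda>z. Left_Ray z (tail_graph (\<lambda>w. f (- w)) z)) ` {z. - x < z \<and> tail_graph (\<lambda>w. f (- w)) z \<noteq> {}})"

lemma coords_support: "{i. coords \<beta> f x i \<noteq> 0} \<subseteq> coord_support f x"
proof
  fix i assume "i \<in> {i. coords \<beta> f x i \<noteq> 0}"
  then show "i \<in> coord_support f x"
    by (cases i) (auto simp: coord_support_def dest: ray_nonzeroD)
qed

lemma finite_coord_support: "fin_supp f \<Longrightarrow> finite (coord_support f x)"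
  unfolding coord_support_def
  by (intro finite.insertI finite_UnI finite_imageI finite_ray_positions fin_supp_mirror)

lemma finite_coords: "fin_supp f \<Longrightarrow> finite {i. coords \<beta> f x i \<noteq> 0}"
  using coords_support finite_coord_support finite_subset by metis

definition coord_index :: "coord set" where
  "coord_index = insert Cursor (range Lamp \<union>
    (\<lambda>(z, T). Right_Ray z T) ` (UNIV \<times> Collect finite) \<union> (\<lambda>(z, T). Left_Ray z T) ` (UNIV \<times> Collect finite))"

lemma countable_coord_index: "countable coord_index"
  unfolding coord_index_def
  by (intro countable_insert countable_Un countable_image countable_SIGMA countable_Collect_finite) auto

lemma coord_support_index: "fin_supp f \<Longrightarrow> coord_support f x \<subseteq> coord_index"
  by (auto simp: coord_support_def coord_index_def image_iff finite_tail_graph fin_supp_mirror)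

text \<open>
  Moving the cursor by one does not change any label and shifts the profile \<open>k powr \<beta>\<close> by one.
\<close>

lemma ray_edge_sum:
  assumes \<beta>: "0 < \<beta>" "\<beta> < 1 / 2" and Z: "finite Z"
  shows "(\<Sum>z\<in>Z. (ray \<beta> f x z (tail_graph f z) - ray \<beta> f (x + 1) z (tail_graph f z))\<^sup>2)
    \<le> (\<Sum>k. (real (Suc k) powr \<beta> - real k powr \<beta>)\<^sup>2)"
proof -
  let ?d = "\<lambda>k. (real (Suc k) powr \<beta> - real k powr \<beta>)\<^sup>2"
  let ?Z = "Z \<inter> {x<..}"
  let ?r = "\<lambda>z. (ray \<beta> f x z (tail_graph f z) - ray \<beta> f (x + 1) z (tail_graph f z))\<^sup>2"
  have "(\<Sum>z\<in>Z. ?r z) = (\<Sum>z\<in>?Z. ?r z)"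
    using Z by (intro sum.mono_neutral_right) (auto simp: ray_def)
  also have "\<dots> \<le> (\<Sum>z\<in>?Z. ?d (nat (z - x - 1)))"
  proof (rule sum_mono)
    fix z assume "z \<in> ?Z"
    then have "nat (z - x) = Suc (nat (z - x - 1))" "nat (z - (x + 1)) = nat (z - x - 1)" by auto
    then show "?r z \<le> ?d (nat (z - x - 1))" by (simp add: ray_def)
  qed
  also have "\<dots> = (\<Sum>k\<in>(\<lambda>z. nat (z - x - 1)) ` ?Z. ?d k)"
    by (subst sum.reindex) (auto simp: inj_on_def)
  also have "\<dots> \<le> (\<Sum>k. ?d k)"
    using Z by (intro sum_le_suminf powr_increment_summable \<beta>) auto
  finally show ?thesis .
qed

lemma coords_cursor_edge:
  assumes \<beta>: "0 < \<beta>" "\<beta> < 1 / 2" and f: "fin_supp f"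
  shows "(l2_dist (coords \<beta> f x) (coords \<beta> f (x + 1)))\<^sup>2
    \<le> 1 + 2 * (\<Sum>k. (real (Suc k) powr \<beta> - real k powr \<beta>)\<^sup>2)"
proof -
  let ?f = "\<lambda>w. f (- w)"
  let ?P = "\<Sum>k. (real (Suc k) powr \<beta> - real k powr \<beta>)\<^sup>2"
  let ?d = "\<lambda>i. (coords \<beta> f x i - coords \<beta> f (x + 1) i)\<^sup>2"
  define Z1 where "Z1 = {z. x < z \<and> tail_graph f z \<noteq> {}}"
  define Z2 where "Z2 = {z. - x - 1 < z \<and> tail_graph ?f z \<noteq> {}}"
  have Z: "finite Z1" "finite Z2"
    unfolding Z1_def Z2_def using f by (auto intro: finite_ray_positions fin_supp_mirror)
  define X1 where "X1 = (\<lambda>z. Right_Ray z (tail_graph f z)) ` Z1"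
  define X2 where "X2 = (\<lambda>z. Left_Ray z (tail_graph ?f z)) ` Z2"
  have X: "finite X1" "finite X2" "Cursor \<notin> X1" "Cursor \<notin> X2" "X1 \<inter> X2 = {}"
    using Z by (auto simp: X1_def X2_def)
  have sub: "{i. coords \<beta> f x i \<noteq> coords \<beta> f (x + 1) i} \<subseteq> insert Cursor (X1 \<union> X2)"
  proof
    fix i assume i: "i \<in> {i. coords \<beta> f x i \<noteq> coords \<beta> f (x + 1) i}"
    show "i \<in> insert Cursor (X1 \<union> X2)"
    proof (cases i)
      case (Right_Ray z T)
      then have "ray \<beta> f x z T \<noteq> 0 \<or> ray \<beta> f (x + 1) z T \<noteq> 0" using i by auto
      then show ?thesis using Right_Ray by (auto simp: X1_def Z1_def dest!: ray_nonzeroD)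
    next
      case (Left_Ray z T)
      then have "ray \<beta> ?f (- x) z T \<noteq> 0 \<or> ray \<beta> ?f (- x - 1) z T \<noteq> 0" using i by auto
      then show ?thesis using Left_Ray by (auto simp: X2_def Z2_def dest!: ray_nonzeroD)
    qed (use i in auto)
  qed
  have "(l2_dist (coords \<beta> f x) (coords \<beta> f (x + 1)))\<^sup>2 = (\<Sum>i\<in>insert Cursor (X1 \<union> X2). ?d i)"
    using X sub by (subst l2_dist_superset[of "insert Cursor (X1 \<union> X2)"]) (auto simp: L2_set_def sum_nonneg)
  also have "\<dots> = 1 + (sum ?d X1 + sum ?d X2)"
    using X by (simp add: sum.union_disjoint)
  also have "sum ?d X1 \<le> ?P"
    using ray_edge_sum[OF \<beta> Z(1), of f x] by (simp add: X1_def sum.reindex inj_on_def)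
  also have "sum ?d X2 \<le> ?P"
    using ray_edge_sum[OF \<beta> Z(2), of ?f "- x - 1"]
    by (simp add: X2_def sum.reindex inj_on_def power2_commute)
  finally show ?thesis by simp
qed

text \<open>
  Labels strictly to the right of the cursor do not see the lamp under it.
\<close>

lemma ray_lamp_update: "ray \<beta> (f(x := v)) x z T = ray \<beta> f x z T"
proof (cases "x < z")
  case True
  then have "tail_graph (f(x := v)) z = tail_graph f z" by (auto simp: tail_graph_eq_iff)
  then show ?thesis by (simp add: ray_def)
qed (simp add: ray_def)

lemma coords_lamp_edge:
  "(l2_dist (coords \<beta> f x) (coords \<beta> (f(x := v)) x))\<^sup>2 \<le> (real_of_int (f x - v))\<^sup>2"
proof -
  have mirror: "(\<lambda>w. (f(x := v)) (- w)) = (\<lambda>w. f (- w))(- x := v)" by (auto simp: fun_eq_iff)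
  have "{i. coords \<beta> f x i \<noteq> coords \<beta> (f(x := v)) x i} \<subseteq> {Lamp x}"
  proof
    fix i assume "i \<in> {i. coords \<beta> f x i \<noteq> coords \<beta> (f(x := v)) x i}"
    then show "i \<in> {Lamp x}"
      by (cases i) (auto simp: ray_lamp_update mirror simp del: fun_upd_apply, auto split: if_splits)
  qed
  then have "l2_dist (coords \<beta> f x) (coords \<beta> (f(x := v)) x) =
      L2_set (\<lambda>i. coords \<beta> f x i - coords \<beta> (f(x := v)) x i) {Lamp x}"
    by (intro l2_dist_superset) auto
  then show ?thesis by (simp add: L2_set_def)
qed

lemma coords_edge:
  assumes \<beta>: "0 < \<beta>" "\<beta> < 1 / 2"
  shows "\<exists>L>0. \<forall>p\<in>carrier wreath_ZZ. \<forall>s\<in>std_gens.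
    l2_dist (case_prod (coords \<beta>) p) (case_prod (coords \<beta>) (p \<otimes>\<^bsub>wreath_ZZ\<^esub> s)) \<le> L"
proof -
  define P where "P = (\<Sum>k. (real (Suc k) powr \<beta> - real k powr \<beta>)\<^sup>2)"
  have P: "P \<ge> 0" unfolding P_def by (intro suminf_nonneg powr_increment_summable \<beta>) simp
  have "l2_dist (case_prod (coords \<beta>) p) (case_prod (coords \<beta>) (p \<otimes>\<^bsub>wreath_ZZ\<^esub> s)) \<le> sqrt (1 + 2 * P)"
    if p: "p \<in> carrier wreath_ZZ" and s: "s \<in> std_gens" for p s
  proof (rule real_le_rsqrt)
    obtain f x where fx: "p = (f, x)" "fin_supp f" using p by (rule wreath_carrierE)
    have lamp: "(l2_dist (coords \<beta> f x) (coords \<beta> (f(x := f x + e)) x))\<^sup>2 \<le> 1 + 2 * P"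
      if "e = 1 \<or> e = -1" for e
      using coords_lamp_edge[of \<beta> f x "f x + e"] that P by auto
    have "(l2_dist (coords \<beta> f x) (coords \<beta> f (x + 1)))\<^sup>2 \<le> 1 + 2 * P"
      "(l2_dist (coords \<beta> f x) (coords \<beta> f (x + - 1)))\<^sup>2 \<le> 1 + 2 * P"
      using coords_cursor_edge[OF \<beta> fx(2), of x] coords_cursor_edge[OF \<beta> fx(2), of "x - 1"]
      by (auto simp: P_def l2_dist_commute)
    then show "(l2_dist (case_prod (coords \<beta>) p) (case_prod (coords \<beta>) (p \<otimes>\<^bsub>wreath_ZZ\<^esub> s)))\<^sup>2 \<le> 1 + 2 * P"
      using s lamp[of 1] lamp[of "- 1"] unfolding fx std_gens_def by (auto simp: mult_cursor_move mult_lamp_change)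
  qed
  then show ?thesis using P by (intro exI[of _ "sqrt (1 + 2 * P)"]) auto
qed

text \<open>
  At each position up to a place where \<open>f\<close> and \<open>g\<close> differ, their labels differ, and at least one of
  the labels is nonempty. In that direction, one of the two vectors vanishes and the other has its full coordinate.
\<close>

lemma ray_separates:
  assumes \<beta>: "0 \<le> \<beta>" and w: "f w \<noteq> g w" "z \<le> w"
  shows "\<exists>T. (real (nat (z - max x y)) powr \<beta>)\<^sup>2 \<le> (ray \<beta> f x z T - ray \<beta> g y z T)\<^sup>2"
proof -
  have ne: "tail_graph f z \<noteq> tail_graph g z" using w by (auto simp: tail_graph_eq_iff)
  have "real (nat (z - max x y)) powr \<beta> \<le> real (nat (z - x)) powr \<beta>"
    "real (nat (z - max x y)) powr \<beta> \<le> real (nat (z - y)) powr \<beta>"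
    using \<beta> by (intro powr_mono2; simp)+
  then have le: "(real (nat (z - max x y)) powr \<beta>)\<^sup>2 \<le> (real (nat (z - x)) powr \<beta>)\<^sup>2"
    "(real (nat (z - max x y)) powr \<beta>)\<^sup>2 \<le> (real (nat (z - y)) powr \<beta>)\<^sup>2"
    by (intro power_mono; simp)+
  show ?thesis
  proof (cases "tail_graph f z = {}")
    case True
    then show ?thesis using ne le(2) by (intro exI[of _ "tail_graph g z"]) (simp add: ray_def)
  next
    case False
    then show ?thesis using ne le(1) by (intro exI[of _ "tail_graph f z"]) (simp add: ray_def)
  qed
qed

lemma ray_separation_sum:
  assumes \<beta>: "0 < \<beta>" "\<beta> < 1 / 2" and w: "f w \<noteq> g w"
  shows "\<exists>Z T. finite Z \<and> real (nat (w - max x y)) powr (2 * \<beta> + 1) / 2 \<le>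
    (\<Sum>z\<in>Z. (ray \<beta> f x z (T z) - ray \<beta> g y z (T z))\<^sup>2)"
proof -
  let ?m = "max x y"
  have "\<forall>z. \<exists>T. z \<le> w \<longrightarrow> (real (nat (z - ?m)) powr \<beta>)\<^sup>2 \<le> (ray \<beta> f x z T - ray \<beta> g y z T)\<^sup>2"
    using ray_separates[of \<beta> f w g] \<beta> w by (metis less_imp_le)
  then obtain T where T: "\<And>z. z \<le> w \<Longrightarrow>
      (real (nat (z - ?m)) powr \<beta>)\<^sup>2 \<le> (ray \<beta> f x z (T z) - ray \<beta> g y z (T z))\<^sup>2" by metis
  have "real (nat (w - ?m)) powr (2 * \<beta> + 1) / 2 \<le> (\<Sum>k=1..nat (w - ?m). (real k powr \<beta>)\<^sup>2)"
    by (rule powr_sum_ge[OF \<beta>])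
  also have "\<dots> = (\<Sum>z\<in>{?m<..w}. (real (nat (z - ?m)) powr \<beta>)\<^sup>2)"
    by (rule sum.reindex_bij_witness[of _ "\<lambda>z. nat (z - ?m)" "\<lambda>k. ?m + int k"]) auto
  also have "\<dots> \<le> (\<Sum>z\<in>{?m<..w}. (ray \<beta> f x z (T z) - ray \<beta> g y z (T z))\<^sup>2)"
    by (intro sum_mono T) auto
  finally show ?thesis by (intro exI[of _ "{?m<..w}"] exI[of _ T]) simp
qed

context
  fixes f g :: "int \<Rightarrow> int" and x y :: int and \<beta> s :: real
  assumes fin: "fin_supp f" "fin_supp g"
  defines "s \<equiv> l2_dist (coords \<beta> f x) (coords \<beta> g y)"
begin

lemma coords_dist_ge:
  assumes "finite J"
  shows "(\<Sum>i\<in>J. (coords \<beta> f x i - coords \<beta> g y i)\<^sup>2) \<le> s\<^sup>2"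
  unfolding s_def by (rule l2_dist_ge[OF finite_coords[OF fin(1)] finite_coords[OF fin(2)] assms])

lemma coords_dist_cursor: "(real_of_int (x - y))\<^sup>2 \<le> s\<^sup>2"
  using coords_dist_ge[of "{Cursor}"] by simp

lemma coords_dist_lamps:
  assumes "finite X"
  shows "(\<Sum>z\<in>X. (real_of_int (f z - g z))\<^sup>2) \<le> s\<^sup>2"
  using coords_dist_ge[of "Lamp ` X"] assms by (simp add: sum.reindex inj_on_def)

lemma coords_dist_right:
  assumes \<beta>: "0 < \<beta>" "\<beta> < 1 / 2" and w: "f w \<noteq> g w"
  shows "real (nat (w - max x y)) powr (2 * \<beta> + 1) / 2 \<le> s\<^sup>2"
proof -
  obtain Z T where "finite Z" "real (nat (w - max x y)) powr (2 * \<beta> + 1) / 2 \<le>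
    (\<Sum>z\<in>Z. (ray \<beta> f x z (T z) - ray \<beta> g y z (T z))\<^sup>2)"
    using ray_separation_sum[where f = f and g = g, OF \<beta> w] by blast
  then show ?thesis
    using coords_dist_ge[of "(\<lambda>z. Right_Ray z (T z)) ` Z"] by (simp add: sum.reindex inj_on_def)
qed

lemma coords_dist_left:
  assumes \<beta>: "0 < \<beta>" "\<beta> < 1 / 2" and w: "f w \<noteq> g w"
  shows "real (nat (min x y - w)) powr (2 * \<beta> + 1) / 2 \<le> s\<^sup>2"
proof -
  have "f (- (- w)) \<noteq> g (- (- w))" using w by simp
  then obtain Z T where "finite Z" "real (nat (- w - max (- x) (- y))) powr (2 * \<beta> + 1) / 2 \<le>
    (\<Sum>z\<in>Z. (ray \<beta> (\<lambda>w. f (- w)) (- x) z (T z) - ray \<beta> (\<lambda>w. g (- w)) (- y) z (T z))\<^sup>2)"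
    using ray_separation_sum[where f = "\<lambda>w. f (- w)" and g = "\<lambda>w. g (- w)", OF \<beta>] by blast
  moreover have "- w - max (- x) (- y) = min x y - w" by simp
  ultimately show ?thesis
    using coords_dist_ge[of "(\<lambda>z. Left_Ray z (T z)) ` Z"] by (simp add: sum.reindex inj_on_def)
qed

lemma coords_dist_ge_1:
  assumes "(f, x) \<noteq> (g, y)"
  shows "1 \<le> s"
proof -
  have one: "1 \<le> (real_of_int a)\<^sup>2" if "a \<noteq> 0" for a
  proof -
    have "1 \<le> \<bar>real_of_int a\<bar>" using that by linarith
    then have "1\<^sup>2 \<le> \<bar>real_of_int a\<bar>\<^sup>2" by (intro power_mono) auto
    then show ?thesis by simp
  qed
  have "1 \<le> s\<^sup>2"
  proof (cases "x = y")
    case True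
    then obtain z where "f z \<noteq> g z" using assms by auto
    then show ?thesis using one[of "f z - g z"] coords_dist_lamps[of "{z}"] by simp
  next
    case False
    then show ?thesis using one[of "x - y"] coords_dist_cursor by simp
  qed
  moreover have "0 \<le> s" by (simp add: s_def l2_dist_def L2_set_nonneg)
  ultimately show ?thesis using power2_le_imp_le[of 1 s] by simp
qed

text \<open>
  All parts of the distance are estimated in terms of \<open>s\<close>: with \<open>A = s powr (2 / \<alpha> - 2)\<close>, the cursor
  distance, the range \<open>R\<close> and hence the number \<open>n\<close> of relevant positions are \<open>O(A)\<close>, and
  Cauchy-Schwarz bounds the lamp cost by \<open>sqrt n * s = O(B)\<close>, where \<open>B = s powr (1 / \<alpha>)\<close> satisfies
  \<open>A * s\<^sup>2 = B\<^sup>2\<close>.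
\<close>

lemma word_dist_le_coords_dist:
  assumes \<alpha>: "1 / 2 < \<alpha>" "\<alpha> < 2 / 3" and \<beta>_eq: "2 * \<beta> + 1 = \<alpha> / (1 - \<alpha>)"
  shows "real (word_dist wreath_ZZ std_gens (f, x) (g, y)) \<le> 16 * s powr (1 / \<alpha>)"
proof (cases "(f, x) = (g, y)")
  case True
  then show ?thesis using fin by (simp add: wr.word_dist_refl carrier_wreath)
next
  case False
  then have s1: "1 \<le> s" by (rule coords_dist_ge_1)
  have "1 < \<alpha> / (1 - \<alpha>)" "\<alpha> / (1 - \<alpha>) < 2" using \<alpha> by (auto simp: field_simps)
  then have \<beta>: "0 < \<beta>" "\<beta> < 1 / 2" using \<beta>_eq by auto
  define A where "A = s powr (2 / \<alpha> - 2)"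
  define B where "B = s powr (1 / \<alpha>)"
  have "1 \<le> 2 / \<alpha> - 2" "2 / \<alpha> - 2 \<le> 1 / \<alpha>" using \<alpha> by (auto simp: field_simps)
  then have sA: "s \<le> A" and AB: "A \<le> B"
    using powr_mono[of 1 "2 / \<alpha> - 2" s] powr_mono[of "2 / \<alpha> - 2" "1 / \<alpha>" s] s1
    by (auto simp: A_def B_def)
  have A1: "1 \<le> A" using sA s1 by linarith
  have ABs: "A * s\<^sup>2 = B\<^sup>2"
  proof -
    have "s\<^sup>2 = s powr 2" using s1 by simp
    then have "A * s\<^sup>2 = s powr (2 / \<alpha> - 2 + 2)" by (simp only: A_def powr_add)
    also have "\<dots> = B\<^sup>2" by (simp add: B_def power2_eq_square flip: powr_add)
    finally show ?thesis .
  qed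
  have range: "real K \<le> 2 * A" if K: "real K powr (2 * \<beta> + 1) / 2 \<le> s\<^sup>2" for K :: nat
  proof (cases "K = 0")
    case False
    let ?e = "(1 - \<alpha>) / \<alpha>"
    have e: "0 < ?e" "?e \<le> 1" "(2 * \<beta> + 1) * ?e = 1" using \<alpha> by (auto simp: \<beta>_eq)
    have "real K = (real K powr (2 * \<beta> + 1)) powr ?e"
      using False e(3) by (simp only: powr_powr) simp
    also have "\<dots> \<le> (2 * s\<^sup>2) powr ?e" using K e by (intro powr_mono2) auto
    also have "\<dots> = 2 powr ?e * (s powr 2) powr ?e" using s1 by (simp add: powr_mult)
    also have "(s powr 2) powr ?e = A"
      unfolding powr_powr A_def using \<alpha> by (intro arg_cong[of _ _ "(powr) s"]) (auto simp: field_simps)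
    also have "2 powr ?e * A \<le> 2 powr 1 * A" using e A1 by (intro mult_right_mono powr_mono) auto
    finally show ?thesis by simp
  qed (use A1 in simp)
  define R where "R = nat \<lfloor>2 * A\<rfloor>"
  have R: "real R \<le> 2 * A" using A1 by (simp add: R_def)
  have supp: "min x y - int R \<le> w \<and> w \<le> max x y + int R" if "f w \<noteq> g w" for w
  proof -
    have "int K \<le> \<lfloor>2 * A\<rfloor>" if "real K \<le> 2 * A" for K using that by (simp add: le_floor_iff)
    then have "int (nat (w - max x y)) \<le> \<lfloor>2 * A\<rfloor>" "int (nat (min x y - w)) \<le> \<lfloor>2 * A\<rfloor>"
      using range[OF coords_dist_right[OF \<beta> that]] range[OF coords_dist_left[OF \<beta> that]] by blast+
    then show ?thesis using A1 unfolding R_def by linarith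
  qed
  \<comment> \<open>The element to be written as a word is \<open>(f, x)\<inverse>(g, y) = (h, y - x)\<close>, so positions are shifted by \<open>x\<close>.\<close>
  define lo where "lo = min x y - int R - x"
  define n where "n = nat (max x y - min x y + 2 * int R + 1)"
  define h where "h z = - f (z + x) + g (z + x)" for z
  have n_int: "int n = \<bar>x - y\<bar> + 2 * int R + 1" by (simp add: n_def max_def min_def)
  have hsupp: "lo \<le> z \<and> z < lo + int n" if "h z \<noteq> 0" for z
    using supp[of "z + x"] that unfolding h_def lo_def n_int by (auto simp: max_def min_def split: if_splits)
  obtain ws where ws: "set ws \<subseteq> std_gens" "word_eval wreath_ZZ ws = (h, - x + y)"
    "int (length ws) = \<bar>lo\<bar> + int n + (\<Sum>z\<in>{lo..<lo + int n}. \<bar>h z\<bar>) + \<bar>- x + y - lo - int n\<bar>"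
    using wreath_word[of h lo n "- x + y"] hsupp by blast
  have "inv\<^bsub>wreath_ZZ\<^esub> (f, x) \<otimes>\<^bsub>wreath_ZZ\<^esub> (g, y) = word_eval wreath_ZZ ws"
    unfolding ws(2) inv_wreath[OF fin(1)] mult_wreath h_def by simp
  then have le: "word_dist wreath_ZZ std_gens (f, x) (g, y) \<le> length ws"
    by (rule wr.word_dist_le[OF ws(1)])
  define N where "N = (\<Sum>z\<in>{lo..<lo + int n}. \<bar>real_of_int (h z)\<bar>)"
  have xy: "real_of_int \<bar>x - y\<bar> \<le> A"
  proof -
    have "\<bar>real_of_int (x - y)\<bar> \<le> s" using coords_dist_cursor s1 by (simp add: abs_le_square_iff[symmetric])
    then show ?thesis using sA by linarith
  qed
  have n: "real n \<le> 6 * A"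
  proof -
    have "real n = real_of_int (int n)" by simp
    also have "\<dots> = real_of_int \<bar>x - y\<bar> + 2 * real R + 1" unfolding n_int by simp
    finally show ?thesis using xy R A1 by linarith
  qed
  have "N\<^sup>2 \<le> (\<Sum>z\<in>{lo..<lo + int n}. \<bar>real_of_int (h z)\<bar>\<^sup>2) * real n"
    unfolding N_def using sum_squared_le_sum_of_squares[of "\<lambda>z. \<bar>real_of_int (h z)\<bar>" "{lo..<lo + int n}"] by simp
  also have "(\<Sum>z\<in>{lo..<lo + int n}. \<bar>real_of_int (h z)\<bar>\<^sup>2)
      = (\<Sum>z\<in>(\<lambda>z. z + x) ` {lo..<lo + int n}. (real_of_int (f z - g z))\<^sup>2)"
    by (subst sum.reindex) (auto simp: h_def power2_commute)
  also have "\<dots> * real n \<le> s\<^sup>2 * (6 * A)"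
    using n by (intro mult_mono coords_dist_lamps) auto
  also have "\<dots> = 6 * B\<^sup>2" using ABs by (simp add: mult.commute)
  also have "\<dots> \<le> (3 * B)\<^sup>2" by (simp add: power_mult_distrib)
  finally have NB: "N \<le> 3 * B" using AB A1 by (intro power2_le_imp_le[of N "3 * B"]) auto
  have gen: "a + m + u + b \<le> 2 * d + 2 * r + 1 + m + u" if "a \<le> d + r" "b \<le> d + r + 1"
    for a b d m r u :: int using that by linarith
  have "\<bar>lo\<bar> \<le> \<bar>x - y\<bar> + int R" "\<bar>- x + y - lo - int n\<bar> \<le> \<bar>x - y\<bar> + int R + 1"
    unfolding n_int lo_def by (auto simp: min_def)
  then have "int (length ws) \<le> 2 * \<bar>x - y\<bar> + 2 * int R + 1 + int n + (\<Sum>z\<in>{lo..<lo + int n}. \<bar>h z\<bar>)"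
    unfolding ws(3) by (rule gen)
  then have "real_of_int (int (length ws)) \<le>
      real_of_int (2 * \<bar>x - y\<bar> + 2 * int R + 1 + int n + (\<Sum>z\<in>{lo..<lo + int n}. \<bar>h z\<bar>))"
    by (simp only: of_int_le_iff)
  also have "\<dots> = 2 * real_of_int \<bar>x - y\<bar> + 2 * real R + 1 + real n + N"
    by (simp add: N_def)
  also have "\<dots> \<le> 16 * B"
  proof -
    have "2 * d + 2 * r + 1 + m + N \<le> 16 * B" if "d \<le> A" "r \<le> 2 * A" "m \<le> 6 * A" for d r m
      using that NB AB A1 by linarith
    then show ?thesis using xy R n by blast
  qed
  finally show ?thesis using le by (simp add: B_def)
qed

end

lemma compression_lower_bound:
  assumes \<alpha>: "1 / 2 < \<alpha>" "\<alpha> < 2 / 3"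
  shows "compression_admissible wreath_ZZ std_gens \<alpha>"
proof -
  define \<beta> where "\<beta> = (\<alpha> / (1 - \<alpha>) - 1) / 2"
  have \<beta>_eq: "2 * \<beta> + 1 = \<alpha> / (1 - \<alpha>)"
  proof -
    have "2 * ((a - 1) / 2) + 1 = a" for a :: real by (simp add: field_simps)
    then show ?thesis unfolding \<beta>_def .
  qed
  have "1 < \<alpha> / (1 - \<alpha>)" "\<alpha> / (1 - \<alpha>) < 2" using \<alpha> by (auto simp: field_simps)
  then have \<beta>: "0 < \<beta>" "\<beta> < 1 / 2" using \<beta>_eq by linarith+
  let ?V = "case_prod (coords \<beta>)"
  let ?C = "carrier wreath_ZZ"
  have fin: "finite {i. ?V p i \<noteq> 0}" if "p \<in> ?C" for p
    using that by (rule wreath_carrierE) (simp add: finite_coords)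
  have sub: "{i. ?V p i \<noteq> 0} \<subseteq> coord_index" if p: "p \<in> ?C" for p
  proof -
    obtain f x where "p = (f, x)" "fin_supp f" using p by (rule wreath_carrierE)
    then show ?thesis using subset_trans[OF coords_support coord_support_index] by simp
  qed
  have "\<exists>F. F \<in> ?C \<rightarrow> L2_space \<and>
      (\<forall>p\<in>?C. \<forall>q\<in>?C. L2_norm (\<lambda>t. F p t - F q t) = l2_dist (?V p) (?V q))"
    by (rule l2_realization[OF countable_coord_index sub fin])
  then obtain F where F: "F \<in> ?C \<rightarrow> L2_space"
    and norm: "\<And>p q. p \<in> ?C \<Longrightarrow> q \<in> ?C \<Longrightarrow> L2_norm (\<lambda>t. F p t - F q t) = l2_dist (?V p) (?V q)"
    by (elim exE conjE) (simp only: Ball_def)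
  obtain L where L: "L > 0" and edge: "\<And>p s. p \<in> ?C \<Longrightarrow> s \<in> std_gens \<Longrightarrow>
      l2_dist (?V p) (?V (p \<otimes>\<^bsub>wreath_ZZ\<^esub> s)) \<le> L"
    using coords_edge[OF \<beta>] by (elim exE conjE) (simp only: Ball_def)
  show ?thesis
  proof (rule compression_admissible_rescale[OF F L, of "1 / 16 powr \<alpha>"])
    show "1 / 16 powr \<alpha> > (0::real)" by simp
  next
    fix p q assume pq: "p \<in> ?C" "q \<in> ?C"
    have "l2_dist (?V p) (?V q) \<le> L * real (word_dist wreath_ZZ std_gens p q)"
    proof (rule wr.le_word_dist_if_edges[OF std_gens pq, of "\<lambda>p q. l2_dist (?V p) (?V q)"])
      show "l2_dist (?V p) (?V r) \<le> l2_dist (?V p) (?V q) + l2_dist (?V q) (?V r)"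
        if "p \<in> ?C" "q \<in> ?C" "r \<in> ?C" for p q r
        using that by (intro l2_dist_triangle fin)
      show "l2_dist (?V p) (?V p) = 0" for p by (simp add: l2_dist_def)
      show "l2_dist (?V p) (?V (p \<otimes>\<^bsub>wreath_ZZ\<^esub> s)) \<le> L" if "p \<in> ?C" "s \<in> std_gens" for p s
        using that by (rule edge)
    qed
    then show "L2_norm (\<lambda>t. F p t - F q t) \<le> L * real (word_dist wreath_ZZ std_gens p q)"
      by (simp only: norm[OF pq])
    obtain f x where p: "p = (f, x)" "fin_supp f" using pq(1) by (rule wreath_carrierE)
    obtain g y where q: "q = (g, y)" "fin_supp g" using pq(2) by (rule wreath_carrierE)
    let ?s = "l2_dist (coords \<beta> f x) (coords \<beta> g y)"
    have s: "0 \<le> ?s" by (simp add: l2_dist_def L2_set_nonneg)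
    have "real (word_dist wreath_ZZ std_gens p q) powr \<alpha> \<le> (16 * ?s powr (1 / \<alpha>)) powr \<alpha>"
      using word_dist_le_coords_dist[OF p(2) q(2) \<alpha> \<beta>_eq] \<alpha> by (intro powr_mono2) (auto simp: p q)
    also have "\<dots> = 16 powr \<alpha> * ?s" using s \<alpha> by (simp add: powr_mult powr_powr)
    finally have "real (word_dist wreath_ZZ std_gens p q) powr \<alpha> / 16 powr \<alpha> \<le> ?s"
      by (simp add: pos_divide_le_eq mult.commute)
    then show "1 / 16 powr \<alpha> * real (word_dist wreath_ZZ std_gens p q) powr \<alpha> \<le> L2_norm (\<lambda>t. F p t - F q t)"
      unfolding norm[OF pq] by (simp add: p q)
  qed
qed

section \<open>The compression exponent\<close>

theorem mainTheorem1:
  assumes "fin_sym_gen_set wreath_ZZ S"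
  shows "hilbert_compression_exponent wreath_ZZ S = ereal (2 / 3)"
  unfolding hilbert_compression_exponent_def
proof (rule antisym)
  show "Sup {ereal \<alpha> |\<alpha>. 0 \<le> \<alpha> \<and> compression_admissible wreath_ZZ S \<alpha>} \<le> ereal (2 / 3)"
  proof (rule Sup_least)
    fix e assume "e \<in> {ereal \<alpha> |\<alpha>. 0 \<le> \<alpha> \<and> compression_admissible wreath_ZZ S \<alpha>}"
    then obtain \<alpha> where \<alpha>: "e = ereal \<alpha>" "0 \<le> \<alpha>" "compression_admissible wreath_ZZ S \<alpha>" by blast
    then show "e \<le> ereal (2 / 3)"
      using compression_upper_bound[OF compression_admissible_change_gens[OF group_wreath assms std_gens]]
      by simp
  qed
  show "ereal (2 / 3) \<le> Sup {ereal \<alpha> |\<alpha>. 0 \<le> \<alpha> \<and> compression_admissible wreath_ZZ S \<alpha>}"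
  proof (rule dense_le)
    fix e assume e: "e < ereal (2 / 3)"
    then obtain \<alpha> where \<alpha>: "max e (ereal (1 / 2)) < ereal \<alpha>" "ereal \<alpha> < ereal (2 / 3)"
      using ereal_dense2[of "max e (ereal (1 / 2))" "ereal (2 / 3)"] by auto
    then have "compression_admissible wreath_ZZ S \<alpha>" "0 \<le> \<alpha>"
      using compression_admissible_change_gens[OF group_wreath std_gens assms] compression_lower_bound[of \<alpha>]
      by auto
    then have "ereal \<alpha> \<le> Sup {ereal \<alpha> |\<alpha>. 0 \<le> \<alpha> \<and> compression_admissible wreath_ZZ S \<alpha>}"
      by (intro Sup_upper) auto
    then show "e \<le> Sup {ereal \<alpha> |\<alpha>. 0 \<le> \<alpha> \<and> compression_admissible wreath_ZZ S \<alpha>}"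
      using \<alpha>(1) by (auto intro: order_trans less_imp_le)
  qed
qed

end
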